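(* Let $\mathcal A\in\{\mathcal P,\mathcal B,\mathfrak S,\mathcal H,\mathcal Bs\}$, let $(A,(m_p)_{p\in\mathcal A})$ be an $\mathcal A$-tracial algebra, and let $(a_1,\dots,a_k)$ be a deterministic $U$-invariant $k$-tuple of elements of $A$. For any $p\in\mathcal A_k$, $$\kappa^{\mathcal A}_p(a_1,\dots,a_k)=\delta_{p\in\mathfrak S_k}\prod_{c\text{ cycle of }p}\mathrm{cum}_{\#c}\big((a_i)_{i\in c}\big),$$ where the $(a_i)_{i\in c}$ are ordered according to the cycle $c$, and where $\mathrm{cum}$ denotes the free cumulants, defined recursively by the requirement that for any $n$ and any $(a_1,\dots,a_n)\in A^n$, $$m_{(1,\dots,n)}(a_1,\dots,a_n)=\sum_{\pi\in\mathrm{NC}_n}\ \prod_{\{i_1<\dots<i_l\}\in\pi}\mathrm{cum}_l(a_{i_1},\dots,a_{i_l}),$$ with $\mathrm{NC}_n$ the set of non-crossing partitions of $\{1,\dots,n\}$.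
   Context: Partitions. For $k\ge 0$, $\mathcal P_k$ is the set of partitions of $\{1,\dots,k,1',\dots,k'\}$. A partition is drawn as a diagram with a top row $1,\dots,k$ and a bottom row $1',\dots,k'$. $\mathrm{nc}(p)$ is the number of blocks of $p$; $p\vee p'$ is the finest partition coarser than both; $\mathrm{id}_k=\{\{i,i'\}:1\le i\le k\}$. A permutation $\sigma\in\mathfrak S_k$ is identified with $\{\{i,\sigma(i)'\}\}\in\mathcal P_k$; its cycles are ordered as $(j,\sigma(j),\sigma^2(j),\dots)$. $\mathcal B_k$, $\mathcal H_k$, $\mathcal Bs_k$ are the sets of $p\in\mathcal P_k$ whose blocks all have size $2$, all have even size, all have size at most $2$ respectively; $\mathcal P=\bigcup_k\mathcal P_k$, etc. $p\circ p'$ is obtained by putting $p'$ above $p$, identifying the bottom row of $p'$ with the top row of $p$, then erasing the middle row and keeping connections. $p\otimes p'$ is obtained by putting $p'$ to the right of $p$. Set $d(p,p')=\frac{\mathrm{nc}(p)+\mathrm{nc}(p')}{2}-\mathrm{nc}(p\vee p')$ and $p\le p'$ if $d(\mathrm{id}_k,p)+d(p,p')=d(\mathrm{id}_k,p')$ (a partial order). $\mathcal A$-tracial algebra. For $p\in\mathcal P_k$, $l\ge k$ and $1\le i_1<\dots<i_k\le l$, $\mathrm{Ins}^l_{(i_1,\dots,i_k)}(p)\in\mathcal P_l$ is obtained by relabelling $j\mapsto i_j$, $j'\mapsto i_j'$ in $p$ and adding the blocks $\{i,i'\}$ for $i\notin\{i_1,\dots,i_k\}$. An $\mathcal A$-tracial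 algebra $(A,(m_p)_{p\in\mathcal A})$ is a (complex) algebra $A$ with $k$-linear forms $m_p:A^k\to\mathbb C$ for $p\in\mathcal A_k$ ($m_\emptyset=1$) such that (1) $m_p(a_1,\dots,a_k)=m_{\sigma\circ p\circ\sigma^{-1}}(a_{\sigma^{-1}(1)},\dots,a_{\sigma^{-1}(k)})$ for all $\sigma\in\mathfrak S_k$; (2) $m_p\big(\prod_{i=1}^{n_1}a^{(1)}_i,\dots,\prod_{i=1}^{n_k}a_i^{(k)}\big)=m_{\mathrm{Ins}^{n}_{\mathbf i}(p)\circ\sigma}(a^{(1)}_1,\dots,a^{(1)}_{n_1},\dots,a^{(k)}_1,\dots,a^{(k)}_{n_k})$, with $n=\sum_j n_j$, $\mathbf i=(1,1+n_1,\dots,1+n_1+\dots+n_{k-1})$ and $\sigma=(1,\dots,n_1)(n_1+1,\dots,n_1+n_2)\cdots(n_1+\dots+n_{k-1}+1,\dots,n)$. A family of elements is deterministic if on the algebra it generates $m_{p_1\otimes p_2}(a_1,\dots,a_{k_1+k_2})=m_{p_1}(a_1,\dots,a_{k_1})m_{p_2}(a_{k_1+1},\dots,a_{k_1+k_2})$ for all $p_1\in\mathcal A_{k_1},p_2\in\mathcal A_{k_2}$. For $\mathcal C\in\{\mathcal A,\mathfrak S\}$ the $\mathcal C$-cumulants $(\kappa^{\mathcal C}_p)_{p\in\mathcal C}$ are the unique multilinear forms with $m_p=\sum_{p'\in\mathcal C_k,\,p'\le p}\kappa^{\mathcal C}_{p'}$ for all $k$, $p\in\mathcal C_k$. A family $F\subset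 A$ is $U$-invariant if for all $k$, $p\in\mathcal A_k$ and $(a_1,\dots,a_k)\in F^k$, $\kappa^{\mathcal A}_p(a_1,\dots,a_k)$ equals $\kappa_p^{\mathfrak S}(a_1,\dots,a_k)$ if $p\in\mathfrak S_k$ and $0$ otherwise. A $k$-tuple has one of these properties if the family of its entries does. *)

theory Defs
  imports
    Complex_Main
    "HOL-Library.Disjoint_Sets"
    "HOL-Combinatorics.Cycles"
    "HOL-Combinatorics.Orbits"
begin

section \<open>Diagrams\<close>

text \<open>
  Indices start at \<open>0\<close>: the top row of a diagram of size \<open>k\<close> is \<open>Top 0, \<dots>, Top (k - 1)\<close>, the bottom
  row is \<open>Bot 0, \<dots>, Bot (k - 1)\<close>. The vertices \<open>Mid i\<close> only serve as the middle row that is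
  erased when two diagrams are composed.
\<close>

datatype vertex = Top nat | Bot nat | Mid nat

type_synonym diagram = "vertex set set"

definition vertices :: "nat \<Rightarrow> vertex set" where
  "vertices k = Top ` {..<k} \<union> Bot ` {..<k}"

definition partitions :: "nat \<Rightarrow> diagram set" where
  "partitions k = {p. partition_on (vertices k) p}"

definition pairings :: "nat \<Rightarrow> diagram set" where
  "pairings k = {p \<in> partitions k. \<forall>b\<in>p. card b = 2}"

definition even_partitions :: "nat \<Rightarrow> diagram set" where
  "even_partitions k = {p \<in> partitions k. \<forall>b\<in>p. even (card b)}"

definition partial_pairings :: "nat \<Rightarrow> diagram set" where
  "partial_pairings k = {p \<in> partitions k. \<forall>b\<in>p. card b \<le> 2}"

definition perm_diagram :: "nat \<Rightarrow> (nat \<Rightarrow> nat) \<Rightarrow> diagram" where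
  "perm_diagram k \<sigma> = (\<lambda>i. {Top i, Bot (\<sigma> i)}) ` {..<k}"

definition perm_diagrams :: "nat \<Rightarrow> diagram set" where
  "perm_diagrams k = {perm_diagram k \<sigma> |\<sigma>. \<sigma> permutes {..<k}}"

definition perm_of :: "nat \<Rightarrow> diagram \<Rightarrow> nat \<Rightarrow> nat" where
  "perm_of k p = (THE \<sigma>. \<sigma> permutes {..<k} \<and> p = perm_diagram k \<sigma>)"

text \<open>
  The two arguments of \<open>join\<close> need not have the same support. For two partitions of the same set,
  \<open>join p q\<close> is the finest partition coarser than both; in general it is the finest partition of
  the union of the supports that keeps all connections of \<open>p\<close> and \<open>q\<close>.
\<close>

definition keeps_connections :: "diagram \<Rightarrow> diagram \<Rightarrow> diagram \<Rightarrow> bool" where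
  "keeps_connections p q r \<longleftrightarrow>
     partition_on (\<Union>p \<union> \<Union>q) r \<and> (\<forall>b\<in>p \<union> q. \<exists>c\<in>r. b \<subseteq> c)"

definition join :: "diagram \<Rightarrow> diagram \<Rightarrow> diagram" where
  "join p q = (THE r. keeps_connections p q r \<and>
     (\<forall>r'. keeps_connections p q r' \<longrightarrow> refines (\<Union>p \<union> \<Union>q) r r'))"

fun top_to_mid :: "vertex \<Rightarrow> vertex" where
  "top_to_mid (Top i) = Mid i"
| "top_to_mid v = v"

fun bot_to_mid :: "vertex \<Rightarrow> vertex" where
  "bot_to_mid (Bot i) = Mid i"
| "bot_to_mid v = v"

text \<open>In \<open>diagram_comp p p'\<close> the second diagram \<open>p'\<close> is put above the first one.\<close>

definition diagram_comp :: "diagram \<Rightarrow> diagram \<Rightarrow> diagram" where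
  "diagram_comp p p' =
     (\<lambda>b. b - range Mid) ` join ((`) top_to_mid ` p) ((`) bot_to_mid ` p') - {{}}"

fun relabel :: "(nat \<Rightarrow> nat) \<Rightarrow> vertex \<Rightarrow> vertex" where
  "relabel f (Top i) = Top (f i)"
| "relabel f (Bot i) = Bot (f i)"
| "relabel f (Mid i) = Mid (f i)"

text \<open>In \<open>tensor k p p'\<close> the number \<open>k\<close> is the size of the left diagram \<open>p\<close>.\<close>

definition tensor :: "nat \<Rightarrow> diagram \<Rightarrow> diagram \<Rightarrow> diagram" where
  "tensor k p p' = p \<union> (`) (relabel (\<lambda>i. k + i)) ` p'"

text \<open>\<open>insertion l is p\<close> is \<open>Ins\<^sup>l\<^bsub>is\<^esub>(p)\<close>; \<open>is\<close> lists the positions in increasing order.\<close>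

definition insertion :: "nat \<Rightarrow> nat list \<Rightarrow> diagram \<Rightarrow> diagram" where
  "insertion l is p =
     (`) (relabel (\<lambda>j. is ! j)) ` p \<union> {{Top i, Bot i} |i. i < l \<and> i \<notin> set is}"

definition diagram_dist :: "diagram \<Rightarrow> diagram \<Rightarrow> real" where
  "diagram_dist p p' = (real (card p) + real (card p')) / 2 - real (card (join p p'))"

definition diagram_le :: "nat \<Rightarrow> diagram \<Rightarrow> diagram \<Rightarrow> bool" where
  "diagram_le k p p' \<longleftrightarrow>
     diagram_dist (perm_diagram k id) p + diagram_dist p p' = diagram_dist (perm_diagram k id) p'"


section \<open>Tracial algebras\<close>

text \<open>
  Associative complex algebras, not assumed to be unital. The underlying set is the whole type
  \<open>'a\<close>; scalar multiplication is a parameter because HOL has no type class for complex algebras.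
\<close>

locale complex_algebra = vector_space scale
  for scale :: "complex \<Rightarrow> 'a::ring \<Rightarrow> 'a" +
  assumes scale_mult_left: "scale c x * y = scale c (x * y)"
    and scale_mult_right: "x * scale c y = scale c (x * y)"

definition subalgebra :: "(complex \<Rightarrow> 'a::ring \<Rightarrow> 'a) \<Rightarrow> 'a set \<Rightarrow> bool" where
  "subalgebra scale S \<longleftrightarrow> module.subspace scale S \<and> (\<forall>x\<in>S. \<forall>y\<in>S. x * y \<in> S)"

definition generated_algebra :: "(complex \<Rightarrow> 'a::ring \<Rightarrow> 'a) \<Rightarrow> 'a set \<Rightarrow> 'a set" where
  "generated_algebra scale F = subalgebra scale hull F"

text \<open>Tuples are lists, so a \<open>k\<close>-linear form only matters on lists of length \<open>k\<close>.\<close>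

definition multilinear_form ::
  "(complex \<Rightarrow> 'a::ring \<Rightarrow> 'a) \<Rightarrow> nat \<Rightarrow> ('a list \<Rightarrow> complex) \<Rightarrow> bool" where
  "multilinear_form scale k f \<longleftrightarrow>
     (\<forall>as i. length as = k \<longrightarrow> i < k \<longrightarrow>
        Vector_Spaces.linear scale (*) (\<lambda>x. f (as[i := x])))"

text \<open>The product of a nonempty list, which does not need a unit.\<close>

definition ne_prod :: "'a::ring list \<Rightarrow> 'a" where
  "ne_prod xs = foldl (*) (hd xs) (tl xs)"

definition block_start :: "nat list \<Rightarrow> nat \<Rightarrow> nat" where
  "block_start ns j = sum_list (take j ns)"

text \<open>
  \<open>block_cycles [n\<^sub>1, \<dots>, n\<^sub>k]\<close> is the product of the cycles that run through the successive blocks of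
  sizes \<open>n\<^sub>1, \<dots>, n\<^sub>k\<close> in increasing order.
\<close>

definition block_cycles :: "nat list \<Rightarrow> nat \<Rightarrow> nat" where
  "block_cycles ns =
     foldr (\<circ>) (map (\<lambda>j. cycle_of_list [block_start ns j ..< block_start ns (Suc j)])
       [0..<length ns]) id"

text \<open>
  For \<open>p\<close> in \<open>\<A> k\<close>, the \<open>k\<close>-linear form \<open>m\<^sub>p\<close> is \<open>m p\<close>. The values of \<open>m\<close> on other diagrams, or on
  lists of another length, are not constrained.
\<close>

locale tracial_algebra = complex_algebra scale
  for scale :: "complex \<Rightarrow> 'a::ring \<Rightarrow> 'a" +
  fixes \<A> :: "nat \<Rightarrow> diagram set"
    and m :: "diagram \<Rightarrow> 'a list \<Rightarrow> complex"
  assumes multilinear: "p \<in> \<A> k \<Longrightarrow> multilinear_form scale k (m p)"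
    and empty: "m {} [] = 1"
    and conjugation:
      "p \<in> \<A> k \<Longrightarrow> \<sigma> permutes {..<k} \<Longrightarrow> length as = k \<Longrightarrow>
       m p as =
         m (diagram_comp (diagram_comp (perm_diagram k \<sigma>) p) (perm_diagram k (inv \<sigma>)))
           (map (\<lambda>i. as ! inv \<sigma> i) [0..<k])"
    and products:
      "p \<in> \<A> k \<Longrightarrow> length ass = k \<Longrightarrow> [] \<notin> set ass \<Longrightarrow>
       ns = map length ass \<Longrightarrow> n = sum_list ns \<Longrightarrow>
       m p (map ne_prod ass) =
         m (diagram_comp (insertion n (map (block_start ns) [0..<k]) p)
              (perm_diagram n (block_cycles ns)))
           (concat ass)"

definition deterministic ::
  "(complex \<Rightarrow> 'a::ring \<Rightarrow> 'a) \<Rightarrow> (nat \<Rightarrow> diagram set) \<Rightarrow> (diagram \<Rightarrow> 'a list \<Rightarrow> complex) \<Rightarrow>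
   'a set \<Rightarrow> bool" where
  "deterministic scale \<A> m F \<longleftrightarrow>
     (\<forall>k\<^sub>1 k\<^sub>2. \<forall>p\<^sub>1\<in>\<A> k\<^sub>1. \<forall>p\<^sub>2\<in>\<A> k\<^sub>2. \<forall>as bs.
        length as = k\<^sub>1 \<longrightarrow> length bs = k\<^sub>2 \<longrightarrow> set (as @ bs) \<subseteq> generated_algebra scale F \<longrightarrow>
        m (tensor k\<^sub>1 p\<^sub>1 p\<^sub>2) (as @ bs) = m p\<^sub>1 as * m p\<^sub>2 bs)"


section \<open>Cumulants\<close>

text \<open>
  The last clause of \<open>is_cumulants\<close> fixes the value \<open>0\<close> where the cumulants are not defined; it is
  only there to make them unique as total functions.
\<close>

definition is_cumulants ::
  "(complex \<Rightarrow> 'a::ring \<Rightarrow> 'a) \<Rightarrow> (nat \<Rightarrow> diagram set) \<Rightarrow> (diagram \<Rightarrow> 'a list \<Rightarrow> complex) \<Rightarrow>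
   (diagram \<Rightarrow> 'a list \<Rightarrow> complex) \<Rightarrow> bool" where
  "is_cumulants scale \<C> m \<kappa> \<longleftrightarrow>
     (\<forall>k. \<forall>p\<in>\<C> k. multilinear_form scale k (\<kappa> p)) \<and>
     (\<forall>k. \<forall>p\<in>\<C> k. \<forall>as. length as = k \<longrightarrow>
        m p as = (\<Sum>p'\<in>{p' \<in> \<C> k. diagram_le k p' p}. \<kappa> p' as)) \<and>
     (\<forall>p as. p \<notin> \<C> (length as) \<longrightarrow> \<kappa> p as = 0)"

definition cumulant ::
  "(complex \<Rightarrow> 'a::ring \<Rightarrow> 'a) \<Rightarrow> (nat \<Rightarrow> diagram set) \<Rightarrow> (diagram \<Rightarrow> 'a list \<Rightarrow> complex) \<Rightarrow>
   diagram \<Rightarrow> 'a list \<Rightarrow> complex" where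
  "cumulant scale \<C> m = (THE \<kappa>. is_cumulants scale \<C> m \<kappa>)"

definition U_invariant ::
  "(complex \<Rightarrow> 'a::ring \<Rightarrow> 'a) \<Rightarrow> (nat \<Rightarrow> diagram set) \<Rightarrow> (diagram \<Rightarrow> 'a list \<Rightarrow> complex) \<Rightarrow>
   'a set \<Rightarrow> bool" where
  "U_invariant scale \<A> m F \<longleftrightarrow>
     (\<forall>k. \<forall>p\<in>\<A> k. \<forall>as. length as = k \<longrightarrow> set as \<subseteq> F \<longrightarrow>
        cumulant scale \<A> m p as =
          (if p \<in> perm_diagrams k then cumulant scale perm_diagrams m p as else 0))"

definition noncrossing :: "nat set set \<Rightarrow> bool" where
  "noncrossing \<pi> \<longleftrightarrow>
     \<not> (\<exists>b\<in>\<pi>. \<exists>c\<in>\<pi>. b \<noteq> c \<and>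
          (\<exists>h i j l. h < i \<and> i < j \<and> j < l \<and> h \<in> b \<and> j \<in> b \<and> i \<in> c \<and> l \<in> c))"

definition NC :: "nat \<Rightarrow> nat set set set" where
  "NC n = {\<pi>. partition_on {..<n} \<pi> \<and> noncrossing \<pi>}"

text \<open>
  The list \<open>as\<close> determines the order of the free cumulant. The moment-cumulant relation says nothing
  about the cumulant of order \<open>0\<close>, which is set to \<open>0\<close> and does not occur in any product over
  blocks.
\<close>

definition is_free_cumulants ::
  "(diagram \<Rightarrow> 'a list \<Rightarrow> complex) \<Rightarrow> ('a list \<Rightarrow> complex) \<Rightarrow> bool" where
  "is_free_cumulants m c \<longleftrightarrow>
     (\<forall>n as. length as = n \<longrightarrow>
        m (perm_diagram n (cycle_of_list [0..<n])) as = (\<Sum>\<pi>\<in>NC n. \<Prod>b\<in>\<pi>. c (nths as b))) \<and>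
     c [] = 0"

definition free_cumulant :: "(diagram \<Rightarrow> 'a list \<Rightarrow> complex) \<Rightarrow> 'a list \<Rightarrow> complex" where
  "free_cumulant m = (THE c. is_free_cumulants m c)"

definition cycles :: "nat \<Rightarrow> (nat \<Rightarrow> nat) \<Rightarrow> nat set set" where
  "cycles k \<sigma> = orbit \<sigma> ` {..<k}"

text \<open>The entries of \<open>as\<close> along the cycle \<open>(j, \<sigma> j, \<sigma> (\<sigma> j), \<dots>)\<close>.\<close>

definition along_cycle :: "(nat \<Rightarrow> nat) \<Rightarrow> nat \<Rightarrow> 'a list \<Rightarrow> 'a list" where
  "along_cycle \<sigma> j as = map (\<lambda>t. as ! ((\<sigma> ^^ t) j)) [0..<card (orbit \<sigma> j)]"


section \<open>The definite descriptions are well defined\<close>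

lemma join_ex1:
  assumes "{} \<notin> p \<union> q"
  shows "\<exists>!r. keeps_connections p q r \<and>
           (\<forall>r'. keeps_connections p q r' \<longrightarrow> refines (\<Union>p \<union> \<Union>q) r r')"
proof -
  define V where "V = \<Union>p \<union> \<Union>q"
  define E where "E = {(x, y). \<exists>b\<in>p \<union> q. x \<in> b \<and> y \<in> b}"
  define r where "r = V // E\<^sup>+"
  have EV: "E \<subseteq> V \<times> V" by (auto simp: E_def V_def)
  then have TV: "E\<^sup>+ \<subseteq> V \<times> V" by (rule trancl_subset_Sigma)
  have "equiv V (E\<^sup>+)"
  proof (rule equivI)
    show "E\<^sup>+ \<subseteq> V \<times> V" by (rule TV)
    show "refl_on V (E\<^sup>+)" by (auto simp: refl_on_def E_def V_def)
    show "sym (E\<^sup>+)" by (rule sym_trancl) (auto simp: sym_def E_def)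
    show "trans (E\<^sup>+)" by (rule trans_trancl)
  qed
  note eq = this
  have "keeps_connections p q r"
    unfolding keeps_connections_def
  proof (intro conjI ballI)
    show "partition_on (\<Union>p \<union> \<Union>q) r"
      using partition_on_quotient[OF eq] by (simp add: r_def V_def)
    fix b assume b: "b \<in> p \<union> q"
    with assms obtain x where x: "x \<in> b" by (metis all_not_in_conv)
    show "\<exists>c\<in>r. b \<subseteq> c"
    proof
      show "E\<^sup>+ `` {x} \<in> r" unfolding r_def using b x by (intro quotientI) (auto simp: V_def)
      show "b \<subseteq> E\<^sup>+ `` {x}" using b x by (auto simp: E_def)
    qed
  qed
  moreover have "refines V r r'" if r': "keeps_connections p q r'" for r'
    unfolding refines_def
  proof (intro conjI ballI)
    show pr': "partition_on V r'" using r' by (simp add: keeps_connections_def V_def)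
    show "partition_on V r" using partition_on_quotient[OF eq] by (simp add: r_def)
    fix X assume "X \<in> r"
    then obtain x where x: "x \<in> V" "X = E\<^sup>+ `` {x}" unfolding r_def by (rule quotientE)
    from pr' x(1) obtain Y where Y: "Y \<in> r'" "x \<in> Y" by (auto simp: partition_on_def)
    have step: "z \<in> Y" if "(y, z) \<in> E" "y \<in> Y" for y z
    proof -
      from that(1) obtain b where b: "b \<in> p \<union> q" "y \<in> b" "z \<in> b" by (auto simp: E_def)
      with r' obtain c where c: "c \<in> r'" "b \<subseteq> c" by (auto simp: keeps_connections_def)
      with b that(2) Y(1) pr' have "c = Y" by (auto simp: partition_on_def dest: disjointD)
      with c b show ?thesis by auto
    qed
    have "y \<in> Y" if "(x, y) \<in> E\<^sup>+" for y
      using that by (induction rule: trancl_induct) (auto intro: step Y(2))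
    with x Y show "\<exists>Y\<in>r'. X \<subseteq> Y" by auto
  qed
  ultimately show ?thesis
    unfolding V_def by (intro ex1I[of _ r]) (blast, metis refines_asym)
qed

lemma join_properties:
  assumes "{} \<notin> p \<union> q"
  shows "keeps_connections p q (join p q)"
    and "keeps_connections p q r' \<Longrightarrow> refines (\<Union>p \<union> \<Union>q) (join p q) r'"
  using theI'[OF join_ex1[OF assms]] by (auto simp: join_def)

lemma card_refines:
  assumes "finite A" "refines A p r"
  shows "card r \<le> card p" "card r = card p \<Longrightarrow> r = p"
proof -
  have part: "partition_on A p" "partition_on A r" using assms(2) by (auto simp: refines_def)
  then have fin: "finite p" "finite r"
    using assms(1) by (metis finite_UnionD partition_onD1)+
  from assms(2) obtain f where f: "\<And>X. X \<in> p \<Longrightarrow> f X \<in> r \<and> X \<subseteq> f X"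
    unfolding refines_def by metis
  have surj: "f ` p = r"
  proof
    show "f ` p \<subseteq> r" using f by auto
    show "r \<subseteq> f ` p"
    proof
      fix Y assume Y: "Y \<in> r"
      with part(2) obtain x where x: "x \<in> Y" by (metis all_not_in_conv partition_onD3)
      with Y part have "x \<in> \<Union>p" by (auto simp: partition_on_def)
      then obtain X where X: "X \<in> p" "x \<in> X" by auto
      with f[of X] x Y part(2) have "f X = Y"
        by (auto simp: partition_on_def dest: disjointD)
      with X show "Y \<in> f ` p" by auto
    qed
  qed
  then show "card r \<le> card p" using fin by (metis card_image_le)
  assume eq: "card r = card p"
  then have inj: "inj_on f p" using fin surj by (metis eq_card_imp_inj_on)
  have "f X = X" if X: "X \<in> p" for X
  proof
    show "X \<subseteq> f X" using f X by auto
    show "f X \<subseteq> X"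
    proof
      fix x assume x: "x \<in> f X"
      with f[OF X] part have "x \<in> \<Union>p" by (auto simp: partition_on_def)
      then obtain Z where Z: "Z \<in> p" "x \<in> Z" by auto
      with f[OF Z(1)] f[OF X] x part(2) have "f Z = f X"
        by (auto simp: partition_on_def dest: disjointD)
      with inj Z X have "Z = X" by (auto dest: inj_onD)
      with Z show "x \<in> X" by simp
    qed
  qed
  with surj show "r = p" by force
qed

lemma finite_vertices [simp]: "finite (vertices k)"
  by (simp add: vertices_def)

lemma partition_join:
  assumes "partition_on A p" "partition_on A q"
  shows "refines A p (join p q)" "refines A q (join p q)"
proof -
  have A: "\<Union>p = A" "\<Union>q = A" using assms by (auto simp: partition_on_def)
  have "keeps_connections p q (join p q)"
    using assms by (intro join_properties) (auto simp: partition_on_def)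
  then show "refines A p (join p q)" "refines A q (join p q)"
    using assms by (auto simp: keeps_connections_def refines_def A)
qed

lemma join_self: "partition_on A p \<Longrightarrow> join p p = p"
proof -
  assume p: "partition_on A p"
  have A: "\<Union>p = A" using p by (auto simp: partition_on_def)
  have "keeps_connections p p p" using p by (auto simp: keeps_connections_def A)
  then have "refines A (join p p) p"
    using join_properties(2)[of p p p] p by (auto simp: A partition_on_def)
  with partition_join(1)[OF p p] show ?thesis using refines_asym by metis
qed

lemma diagram_dist_nonneg:
  assumes "partition_on A p" "partition_on A q" "finite A"
  shows "diagram_dist p q \<ge> 0" "diagram_dist p q = 0 \<Longrightarrow> p = q"
proof -
  note j = partition_join[OF assms(1,2)]
  have c: "card (join p q) \<le> card p" "card (join p q) \<le> card q"
    using card_refines(1)[OF assms(3)] j by auto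
  then show "diagram_dist p q \<ge> 0" by (simp add: diagram_dist_def)
  assume "diagram_dist p q = 0"
  with c have "card (join p q) = card p" "card (join p q) = card q"
    by (simp_all add: diagram_dist_def)
  then show "p = q" using card_refines(2)[OF assms(3)] j by metis
qed

lemma diagram_le_refl: "p \<in> partitions k \<Longrightarrow> diagram_le k p p"
  by (simp add: diagram_le_def diagram_dist_def join_self partitions_def)

lemma perm_diagram_partition:
  assumes "\<sigma> permutes {..<k}"
  shows "perm_diagram k \<sigma> \<in> partitions k"
proof -
  have im: "\<sigma> ` {..<k} = {..<k}" using assms by (rule permutes_image)
  have "\<Union>(perm_diagram k \<sigma>) = Top ` {..<k} \<union> Bot ` \<sigma> ` {..<k}"
    by (auto simp: perm_diagram_def)
  moreover have "disjoint (perm_diagram k \<sigma>)"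
    using permutes_inj[OF assms] by (auto simp: perm_diagram_def disjoint_def inj_eq)
  ultimately show ?thesis
    by (auto simp: partitions_def partition_on_def vertices_def im perm_diagram_def)
qed

lemma perm_of_perm_diagram:
  assumes "\<sigma> permutes {..<k}"
  shows "perm_of k (perm_diagram k \<sigma>) = \<sigma>"
  unfolding perm_of_def
proof (rule the_equality)
  fix \<tau> assume \<tau>: "\<tau> permutes {..<k} \<and> perm_diagram k \<sigma> = perm_diagram k \<tau>"
  show "\<tau> = \<sigma>"
  proof
    fix i show "\<tau> i = \<sigma> i"
    proof (cases "i < k")
      case True
      then have "{Top i, Bot (\<tau> i)} \<in> perm_diagram k \<sigma>"
        using \<tau> by (auto simp: perm_diagram_def)
      then obtain j where "{Top i, Bot (\<tau> i)} = {Top j, Bot (\<sigma> j)}"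
        unfolding perm_diagram_def by blast
      then show ?thesis by (auto simp: doubleton_eq_iff)
    next
      case False
      then show ?thesis using \<tau> assms by (metis lessThan_iff permutes_not_in)
    qed
  qed
qed (use assms in auto)

lemma diagram_comp_perm:
  assumes s: "\<sigma> permutes {..<k}" and t: "\<tau> permutes {..<k}"
  shows "diagram_comp (perm_diagram k \<sigma>) (perm_diagram k \<tau>) = perm_diagram k (\<sigma> \<circ> \<tau>)"
proof -
  define P where "P = (`) top_to_mid ` perm_diagram k \<sigma>"
  define Q where "Q = (`) bot_to_mid ` perm_diagram k \<tau>"
  have P: "P = (\<lambda>i. {Mid i, Bot (\<sigma> i)}) ` {..<k}" by (simp add: P_def perm_diagram_def image_image)
  have Q: "Q = (\<lambda>i. {Top i, Mid (\<tau> i)}) ` {..<k}" by (simp add: Q_def perm_diagram_def image_image)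
  define R where "R = (\<lambda>i. {Top i, Mid (\<tau> i), Bot (\<sigma> (\<tau> i))}) ` {..<k}"
  have is_: "\<sigma> ` {..<k} = {..<k}" "\<tau> ` {..<k} = {..<k}" using s t by (simp_all add: permutes_image)
  have P': "P = (\<lambda>i. {Mid (\<tau> i), Bot (\<sigma> (\<tau> i))}) ` {..<k}"
    unfolding P by (subst is_(2)[symmetric]) (simp only: image_image)
  have U: "\<Union>P \<union> \<Union>Q = \<Union>R" unfolding P' Q R_def by auto
  have inj: "inj \<tau>" "inj \<sigma>" using s t permutes_inj by auto
  have pR: "partition_on (\<Union>P \<union> \<Union>Q) R"
    unfolding U by (rule partition_onI) (auto simp: R_def disjnt_def inj_eq inj)
  have kR: "keeps_connections P Q R"
    unfolding keeps_connections_def using pR by (auto simp: P' Q R_def)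
  have ne: "{} \<notin> P \<union> Q" by (auto simp: P Q)
  have "refines (\<Union>P \<union> \<Union>Q) (join P Q) R" using join_properties(2)[OF ne kR] .
  moreover have "refines (\<Union>P \<union> \<Union>Q) R (join P Q)"
  proof -
    have k: "keeps_connections P Q (join P Q)" by (rule join_properties(1)[OF ne])
    have "\<exists>Y\<in>join P Q. X \<subseteq> Y" if X: "X \<in> R" for X
    proof -
      from X obtain i where i: "i < k" "X = {Top i, Mid (\<tau> i), Bot (\<sigma> (\<tau> i))}"
        by (auto simp: R_def)
      have "{Mid (\<tau> i), Bot (\<sigma> (\<tau> i))} \<in> P" "{Top i, Mid (\<tau> i)} \<in> Q" using i by (auto simp: P' Q)
      with k obtain c d where cd: "c \<in> join P Q" "d \<in> join P Q" "{Mid (\<tau> i), Bot (\<sigma> (\<tau> i))} \<subseteq> c"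
        "{Top i, Mid (\<tau> i)} \<subseteq> d" unfolding keeps_connections_def by (meson UnI1 UnI2)
      with k have "c = d" by (auto simp: keeps_connections_def partition_on_def dest: disjointD)
      with cd i show ?thesis by auto
    qed
    with k pR show ?thesis by (auto simp: refines_def keeps_connections_def)
  qed
  ultimately have "join P Q = R" by (rule refines_asym)
  moreover have "(\<lambda>b. b - range Mid) ` R = perm_diagram k (\<sigma> \<circ> \<tau>)"
  proof -
    have "{Top i, Mid j, Bot l} - range Mid = {Top i, Bot l}" for i j l by auto
    then show ?thesis by (simp add: R_def perm_diagram_def image_image)
  qed
  moreover have "{} \<notin> perm_diagram k (\<sigma> \<circ> \<tau>)" by (auto simp: perm_diagram_def)
  ultimately show ?thesis by (simp add: diagram_comp_def P_def Q_def)
qed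

definition diagram_below :: "(nat \<Rightarrow> diagram set) \<Rightarrow> (diagram \<times> diagram) set" where
  "diagram_below C = {(p', p). \<exists>k. p \<in> C k \<and> p' \<in> C k \<and> diagram_le k p' p \<and> p' \<noteq> p}"

lemma partitions_size_unique: "p \<in> partitions k \<Longrightarrow> p \<in> partitions l \<Longrightarrow> k = l"
proof -
  assume "p \<in> partitions k" "p \<in> partitions l"
  then have "vertices k = vertices l" by (auto simp: partitions_def partition_on_def)
  then have "Top -` vertices k = Top -` vertices l" by simp
  moreover have "Top -` vertices n = {..<n}" for n by (auto simp: vertices_def)
  ultimately show "k = l" by simp
qed

lemma finite_partitions [simp]: "finite (partitions k)"
  unfolding partitions_def by (simp add: finitely_many_partition_on)

lemma wf_diagram_below:
  assumes C: "\<And>k. C k \<subseteq> partitions k"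
  shows "wf (diagram_below C)"
proof -
  define D where "D p = (THE x. \<exists>k. p \<in> partitions k \<and>
     x = k + card p - 2 * card (join (perm_diagram k id) p))" for p
  have D: "real (D p) = 2 * diagram_dist (perm_diagram k id) p" if "p \<in> partitions k" for k p
  proof -
    have "D p = k + card p - 2 * card (join (perm_diagram k id) p)"
      unfolding D_def using that partitions_size_unique by (intro the_equality) blast+
    moreover have pp: "partition_on (vertices k) (perm_diagram k id)" "partition_on (vertices k) p"
      using that perm_diagram_partition[OF permutes_id] by (auto simp: partitions_def)
    moreover have "card (perm_diagram k id) = k"
      unfolding perm_diagram_def by (subst card_image) (auto simp: inj_on_def doubleton_eq_iff)
    moreover have "diagram_dist (perm_diagram k id) p \<ge> 0"
      using diagram_dist_nonneg(1)[OF pp] by simp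
    ultimately show ?thesis by (simp add: diagram_dist_def of_nat_diff)
  qed
  have "diagram_below C \<subseteq> measure D"
  proof (clarify)
    fix p' p assume "(p', p) \<in> diagram_below C"
    then obtain k where k: "p \<in> partitions k" "p' \<in> partitions k" "diagram_le k p' p" "p' \<noteq> p"
      using C by (auto simp: diagram_below_def)
    then have "diagram_dist p' p > 0"
      using diagram_dist_nonneg[of "vertices k" p' p] by (auto simp: partitions_def less_le)
    then have "real (D p') < real (D p)" using k D by (auto simp: diagram_le_def)
    then show "(p', p) \<in> measure D" by simp
  qed
  then show ?thesis by (rule wf_subset[rotated]) simp
qed

lemma multilinear_form_diff:
  assumes "multilinear_form scale k f" "multilinear_form scale k g"
  shows "multilinear_form scale k (\<lambda>as. f as - g as)"
  using assms
  by (auto simp: multilinear_form_def Vector_Spaces.linear_iff algebra_simps)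

lemma multilinear_form_sum:
  assumes "finite S" "vector_space scale" "\<And>s. s \<in> S \<Longrightarrow> multilinear_form scale k (f s)"
  shows "multilinear_form scale k (\<lambda>as. \<Sum>s\<in>S. f s as)"
proof -
  have "vector_space ((*) :: complex \<Rightarrow> _)"
    by unfold_locales (auto simp: algebra_simps)
  then show ?thesis
    using assms
    by (auto simp: multilinear_form_def Vector_Spaces.linear_iff sum.distrib sum_distrib_left)
qed

lemma multilinear_form_cong:
  assumes "\<And>as. length as = k \<Longrightarrow> f as = g as"
  shows "multilinear_form scale k f = multilinear_form scale k g"
  using assms by (auto simp: multilinear_form_def)

lemma cumulants_ex1:
  assumes C: "\<And>k. C k \<subseteq> partitions k"
    and V: "vector_space scale"
    and M: "\<And>k p. p \<in> C k \<Longrightarrow> multilinear_form scale k (m p)"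
  shows "\<exists>!\<kappa>. is_cumulants scale C m \<kappa>"
proof -
  note wf = wf_diagram_below[of C, OF C]
  define below where "below k p = {p' \<in> C k. diagram_le k p' p \<and> p' \<noteq> p}" for k p
  define G where "G K p as = (if p \<in> C (length as)
      then m p as - (\<Sum>p'\<in>below (length as) p. K p' as) else 0)"
    for K :: "diagram \<Rightarrow> 'a list \<Rightarrow> complex" and p as
  define \<kappa> where "\<kappa> = wfrec (diagram_below C) G"
  have fin: "finite (C k)" for k using C finite_partitions by (rule finite_subset)
  have \<kappa>: "\<kappa> p as = (if p \<in> C (length as)
      then m p as - (\<Sum>p'\<in>below (length as) p. \<kappa> p' as) else 0)" for p as
  proof -
    have "\<kappa> p as = G (cut \<kappa> (diagram_below C) p) p as"
      unfolding \<kappa>_def by (subst wfrec[OF wf]) rule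
    also have "\<dots> = G \<kappa> p as"
    proof (cases "p \<in> C (length as)")
      case True
      then have "(p', p) \<in> diagram_below C" if "p' \<in> below (length as) p" for p'
        using that by (auto simp: below_def diagram_below_def)
      then show ?thesis by (simp add: G_def cut_apply)
    qed (simp add: G_def)
    finally show ?thesis by (simp add: G_def)
  qed
  have split: "(\<Sum>p'\<in>{p' \<in> C k. diagram_le k p' p}. K p' as) = K p as + (\<Sum>p'\<in>below k p. K p' as)"
    if "p \<in> C k" for k p as and K :: "diagram \<Rightarrow> 'a list \<Rightarrow> complex"
  proof -
    have "{p' \<in> C k. diagram_le k p' p} = insert p (below k p)"
      using that C diagram_le_refl by (auto simp: below_def)
    then show ?thesis using fin by (simp add: below_def)
  qed
  have "multilinear_form scale k (\<kappa> p)" if "p \<in> C k" for k p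
    using that
  proof (induction p rule: wf_induct_rule[OF wf])
    case (1 p)
    have "multilinear_form scale k (\<lambda>as. m p as - (\<Sum>p'\<in>below k p. \<kappa> p' as))"
    proof (intro multilinear_form_diff multilinear_form_sum M V 1(2))
      show "finite (below k p)" using fin by (simp add: below_def)
      show "multilinear_form scale k (\<kappa> p')" if "p' \<in> below k p" for p'
        using that 1 by (auto simp: below_def diagram_below_def)
    qed
    then show ?case
      using \<kappa> 1(2) by (subst multilinear_form_cong) auto
  qed
  moreover have "m p as = (\<Sum>p'\<in>{p' \<in> C k. diagram_le k p' p}. \<kappa> p' as)"
    if "p \<in> C k" "length as = k" for p as k
    using that by (subst split) (auto simp: \<kappa>[of p])
  moreover have "\<kappa> p as = 0" if "p \<notin> C (length as)" for p as using that \<kappa> by simp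
  ultimately have "is_cumulants scale C m \<kappa>" by (auto simp: is_cumulants_def)
  moreover have "\<kappa>' = \<kappa>" if \<kappa>': "is_cumulants scale C m \<kappa>'" for \<kappa>'
  proof -
    have "\<kappa>' p as = \<kappa> p as" for p as
    proof (cases "p \<in> C (length as)")
      case True
      then show ?thesis
      proof (induction p rule: wf_induct_rule[OF wf])
        case (1 p)
        have "\<kappa>' p as = m p as - (\<Sum>p'\<in>below (length as) p. \<kappa>' p' as)"
          using \<kappa>' 1(2) split[OF 1(2), of \<kappa>'] by (simp add: is_cumulants_def)
        also have "(\<Sum>p'\<in>below (length as) p. \<kappa>' p' as) = (\<Sum>p'\<in>below (length as) p. \<kappa> p' as)"
          using 1 by (intro sum.cong) (auto simp: below_def diagram_below_def)
        finally show ?case using \<kappa>[of p] 1(2) by simp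
      qed
    next
      case False
      then show ?thesis using \<kappa>' \<kappa>[of p as] by (simp add: is_cumulants_def)
    qed
    then show ?thesis by blast
  qed
  ultimately show ?thesis by blast
qed

lemma (in tracial_algebra) tracial_cumulants_ex1:
  assumes "\<A> \<in> {partitions, pairings, perm_diagrams, even_partitions, partial_pairings}"
  shows "\<exists>!\<kappa>. is_cumulants scale \<A> m \<kappa>" "\<exists>!\<kappa>. is_cumulants scale perm_diagrams m \<kappa>"
proof -
  have S: "perm_diagrams k \<subseteq> partitions k" for k
    using perm_diagram_partition by (auto simp: perm_diagrams_def)
  have P: "\<forall>b\<in>p. card b = 2" if "p \<in> perm_diagrams k" for p k
    using that by (auto simp: perm_diagrams_def perm_diagram_def)
  have sub: "\<A> k \<subseteq> partitions k" for k
    using assms S by (auto simp: pairings_def even_partitions_def partial_pairings_def)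
  have sup: "perm_diagrams k \<subseteq> \<A> k" for k
    using assms S P by (fastforce simp: pairings_def even_partitions_def partial_pairings_def)
  show "\<exists>!\<kappa>. is_cumulants scale \<A> m \<kappa>"
    using sub vector_space_axioms multilinear by (rule cumulants_ex1)
  show "\<exists>!\<kappa>. is_cumulants scale perm_diagrams m \<kappa>"
    using S vector_space_axioms multilinear sup by (intro cumulants_ex1) blast+
qed

lemma free_cumulants_ex1:
  fixes m :: "diagram \<Rightarrow> 'a list \<Rightarrow> complex"
  assumes "m {} [] = 1"
  shows "\<exists>!c. is_free_cumulants m c"
proof -
  define M where "M as = m (perm_diagram (length as) (cycle_of_list [0..<length as])) as" for as
  define N where "N n = NC n - {{{..<n}}}" for n
  define G where "G c as = (if as = [] then 0
      else M as - (\<Sum>\<pi>\<in>N (length as). \<Prod>b\<in>\<pi>. c (nths as b)))" for c :: "'a list \<Rightarrow> complex" and as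
  define c where "c = wfrec (measure length) G"
  have fin: "finite (NC n)" for n
    unfolding NC_def by (rule finite_subset[OF _ finitely_many_partition_on[of "{..<n}"]]) auto
  have shorter: "length (nths as b) < length as" if "\<pi> \<in> N (length as)" "b \<in> \<pi>" for as :: "'a list" and \<pi> b
  proof -
    have part: "partition_on {..<length as} \<pi>" and ne: "\<pi> \<noteq> {{..<length as}}"
      using that by (auto simp: N_def NC_def)
    have "b \<subseteq> {..<length as}" using part that(2) by (auto simp: partition_on_def)
    moreover have "b \<noteq> {..<length as}"
    proof
      assume b: "b = {..<length as}"
      have "\<pi> = {b}"
      proof (intro equalityI subsetI)
        fix x assume x: "x \<in> \<pi>"
        with part have "x \<noteq> {}" "x \<subseteq> b" by (auto simp: partition_on_def b)
        then have "x \<inter> b \<noteq> {}" by auto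
        then show "x \<in> {b}" using part x that(2) by (auto simp: partition_on_def dest: disjointD)
      qed (use that in auto)
      with ne b show False by simp
    qed
    ultimately have "b \<subset> {..<length as}" by auto
    then have "card b < length as" by (metis card_lessThan finite_lessThan psubset_card_mono)
    moreover have "{i. i < length as \<and> i \<in> b} = b" using \<open>b \<subseteq> _\<close> by auto
    ultimately show ?thesis by (simp add: length_nths)
  qed
  have c: "c as = G c as" for as
  proof -
    have "c as = G (cut c (measure length) as) as"
      unfolding c_def by (subst wfrec) auto
    also have "\<dots> = G c as"
      unfolding G_def using shorter by (auto intro!: sum.cong prod.cong simp: cut_def)
    finally show ?thesis .
  qed
  have top: "{{..<n}} \<in> NC n" if "n > 0" for n :: nat
    using that by (auto simp: NC_def noncrossing_def partition_on_space lessThan_empty_iff)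
  have split: "(\<Sum>\<pi>\<in>NC (length as). \<Prod>b\<in>\<pi>. d (nths as b)) =
      d as + (\<Sum>\<pi>\<in>N (length as). \<Prod>b\<in>\<pi>. d (nths as b))" if "as \<noteq> []"
    for as and d :: "'a list \<Rightarrow> complex"
  proof -
    have "nths as {..<length as} = as" by (rule nths_all) auto
    then show ?thesis
      using that fin top[of "length as"] by (subst sum.remove[of _ "{{..<length as}}"]) (auto simp: N_def)
  qed
  have NC0: "NC 0 = {{}}" by (auto simp: NC_def noncrossing_def partition_on_empty)
  have "is_free_cumulants m c"
    unfolding is_free_cumulants_def
  proof (intro conjI allI impI)
    show "c [] = 0" by (simp add: c[of "[]"] G_def)
    fix n and as :: "'a list" assume n: "length as = n"
    show "m (perm_diagram n (cycle_of_list [0..<n])) as = (\<Sum>\<pi>\<in>NC n. \<Prod>b\<in>\<pi>. c (nths as b))"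
    proof (cases "as = []")
      case True
      then show ?thesis using n assms by (simp add: NC0 perm_diagram_def)
    next
      case False
      then show ?thesis using split[OF False, of c] c[of as] n by (simp add: G_def M_def)
    qed
  qed
  moreover have "d = c" if d: "is_free_cumulants m d" for d
  proof
    fix as show "d as = c as"
    proof (induction as rule: measure_induct_rule[of length])
      case (less as)
      have "d as = G d as"
      proof (cases "as = []")
        case False
        have "M as = (\<Sum>\<pi>\<in>NC (length as). \<Prod>b\<in>\<pi>. d (nths as b))"
          using d by (simp add: is_free_cumulants_def M_def)
        then show ?thesis using split[OF False, of d] False by (simp add: G_def)
      qed (use d in \<open>simp add: is_free_cumulants_def G_def\<close>)
      also have "\<dots> = G c as"
        unfolding G_def using less shorter by (auto intro!: sum.cong prod.cong)
      finally show ?case using c[of as] by simp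
    qed
  qed
  ultimately show ?thesis by blast
qed

end

theory Submission
  imports Defs
begin

text \<open>
  On a \<open>U\<close>-invariant family the cumulants of \<open>\<A>\<close> vanish outside the permutation diagrams, where they
  are the cumulants of the symmetric groups, so everything happens inside these groups. There the
  order of diagrams is the geodesic order: the length \<open>|\<sigma>| = k - #cycles \<sigma>\<close> is the word length with
  respect to transpositions, the blocks of the join of two permutation diagrams correspond to the
  cycles of \<open>\<sigma>\<^sup>-\<^sup>1 \<tau>\<close> (\<open>join_perm_diagrams\<close>), and hence \<open>\<tau>\<close> lies below \<open>\<sigma>\<close> iff
  \<open>|\<tau>| + |\<tau>\<^sup>-\<^sup>1 \<sigma>| = |\<sigma>|\<close>. Since the cumulants are determined by the moments through
  summation over this order, it suffices to show that the products of free cumulants over cycles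
  satisfy the same relation: \<open>m\<^sub>\<sigma>\<close> is the sum, over all \<open>\<tau>\<close> below \<open>\<sigma>\<close>, of the product of the free
  cumulants along the cycles of \<open>\<tau>\<close> (\<open>moment_formula\<close>).

  The key to the order is the triangle inequality for \<open>|\<cdot>|\<close> together with its case of equality:
  if \<open>|\<alpha> \<beta>| = |\<alpha>| + |\<beta>|\<close>, then every cycle of \<open>\<alpha>\<close> lies inside a cycle of \<open>\<alpha> \<beta>\<close>
  (\<open>card_cycles_comp_le\<close>). It has two consequences. First, below a direct sum of permutations
  there are only direct sums (\<open>perms_below_direct_sum\<close>). Secondly, \<open>\<tau>\<close> lies below the long cycle iff
  its cycles form a non-crossing partition and each of them is traversed in increasing order, which
  gives a bijection onto the non-crossing partitions (\<open>bij_betw_cycles_NC\<close>). Necessity follows by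
  applying the case of equality after multiplying \<open>\<tau>\<close> and the long cycle by a transposition
  \<open>(x y)\<close> with \<open>x\<close>, \<open>y\<close> in one cycle of \<open>\<tau>\<close>: the long cycle then splits into two arcs, and the cycles
  of \<open>(x y) \<tau>\<close> have to respect them. Sufficiency is an induction that adds the last point.

  Through this bijection the defining relation of the free cumulants is the moment formula for a
  long cycle. A general permutation is conjugate to the direct sum of a long cycle and a smaller
  permutation, so that invariance of the moments under conjugation and multiplicativity on
  deterministic families give the formula by induction. Free cumulants are invariant under cyclic
  rotation (\<open>free_cumulants_rotate1\<close>), hence the point at which a cycle starts does not matter.
\<close>

section \<open>Cycles and transpositions\<close>

lemma orbit_least:
  assumes "x \<in> X" "\<And>y. y \<in> X \<Longrightarrow> f y \<in> X"
  shows "orbit f x \<subseteq> X"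
proof
  fix y assume "y \<in> orbit f x" then show "y \<in> X" by induction (auto intro: assms)
qed

lemma orbit_eq:
  assumes "permutation f" "y \<in> orbit f x"
  shows "orbit f y = orbit f x"
  using cyclic_on_orbit'[OF assms(1)] assms(2) by (rule orbit_cyclic_eq3)

text \<open>
  The new permutation runs through the orbit of \<open>j\<close> after leaving \<open>i\<close>, and through the orbit of \<open>i\<close>
  after leaving \<open>j\<close>.
\<close>

lemma orbit_comp_transpose_merge:
  assumes \<sigma>: "permutation \<sigma>" and j: "j \<notin> orbit \<sigma> i"
  shows "orbit (\<sigma> \<circ> transpose i j) x =
    (if x \<in> orbit \<sigma> i \<union> orbit \<sigma> j then orbit \<sigma> i \<union> orbit \<sigma> j else orbit \<sigma> x)"
proof -
  define \<tau> where "\<tau> = \<sigma> \<circ> transpose i j"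
  have \<tau>: "permutation \<tau>" unfolding \<tau>_def using \<sigma> permutation_swap_id by (rule permutation_compose)
  have i: "i \<notin> orbit \<sigma> j" using j orbit_eq[OF \<sigma>] permutation_self_in_orbit[OF \<sigma>] by metis
  have \<tau>': "\<tau> i = \<sigma> j" "\<tau> j = \<sigma> i" "z \<noteq> i \<Longrightarrow> z \<noteq> j \<Longrightarrow> \<tau> z = \<sigma> z" for z
    by (auto simp: \<tau>_def transpose_def)
  have B: "orbit \<sigma> j \<subseteq> orbit \<tau> i"
  proof
    fix y assume "y \<in> orbit \<sigma> j"
    then show "y \<in> orbit \<tau> i"
    proof induction
      case base show ?case using \<tau>'(1) by (metis orbit.base)
    next
      case (step y)
      then show ?case using \<tau>' i by (metis orbit.intros)
    qed
  qed
  have A: "orbit \<sigma> i \<subseteq> orbit \<tau> j"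
  proof
    fix y assume "y \<in> orbit \<sigma> i"
    then show "y \<in> orbit \<tau> j"
    proof induction
      case base show ?case using \<tau>'(2) by (metis orbit.base)
    next
      case (step y)
      then show ?case using \<tau>' j by (metis orbit.intros)
    qed
  qed
  have self: "z \<in> orbit \<sigma> z" "z \<in> orbit \<tau> z" for z
    using permutation_self_in_orbit[OF \<sigma>] permutation_self_in_orbit[OF \<tau>] by auto
  have eq: "orbit \<tau> j = orbit \<tau> i" using B self orbit_eq[OF \<tau>] by blast
  have "orbit \<tau> i \<subseteq> orbit \<sigma> i \<union> orbit \<sigma> j"
  proof (rule orbit_least)
    fix y assume "y \<in> orbit \<sigma> i \<union> orbit \<sigma> j"
    then show "\<tau> y \<in> orbit \<sigma> i \<union> orbit \<sigma> j"
      using \<tau>' by (cases "y = i"; cases "y = j") (auto intro: orbit.intros)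
  qed (use self in auto)
  with A B eq have AB: "orbit \<tau> i = orbit \<sigma> i \<union> orbit \<sigma> j" by auto
  show ?thesis
  proof (cases "x \<in> orbit \<sigma> i \<union> orbit \<sigma> j")
    case True
    then show ?thesis using AB orbit_eq[OF \<tau>, of x i] by (simp add: \<tau>_def)
  next
    case False
    have "orbit \<tau> x = orbit \<sigma> x"
    proof (rule orbit_cong)
      fix s assume "s \<in> orbit \<sigma> x"
      then have "orbit \<sigma> s = orbit \<sigma> x" by (rule orbit_eq[OF \<sigma>])
      then have "s \<noteq> i" "s \<noteq> j" using False self by auto
      then show "\<tau> s = \<sigma> s" by (rule \<tau>'(3))
    qed (rule self)
    then show ?thesis using False by (simp add: \<tau>_def)
  qed
qed

text \<open>
  Together with \<open>orbit_comp_transpose_merge\<close>, applied to the new permutation, this shows that a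
  transposition of two points of the same cycle splits it into exactly two.
\<close>

lemma orbit_comp_transpose_split:
  assumes \<sigma>: "permutation \<sigma>" and j: "j \<in> orbit \<sigma> i" and ij: "i \<noteq> j"
  shows "j \<notin> orbit (\<sigma> \<circ> transpose i j) i"
proof -
  define \<tau> where "\<tau> = \<sigma> \<circ> transpose i j"
  have \<tau>: "permutation \<tau>" unfolding \<tau>_def using \<sigma> permutation_swap_id by (rule permutation_compose)
  define t where "t = (LEAST t. 0 < t \<and> (\<sigma> ^^ t) i = j)"
  have t: "0 < t" "(\<sigma> ^^ t) i = j"
    using LeastI_ex[of "\<lambda>t. 0 < t \<and> (\<sigma> ^^ t) i = j"] j by (auto simp: t_def orbit_altdef)
  have least: "(\<sigma> ^^ s) i \<noteq> j" if "0 < s" "s < t" for s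
    using not_less_Least[of s "\<lambda>t. 0 < t \<and> (\<sigma> ^^ t) i = j"] that by (auto simp: t_def)
  \<comment> \<open>The stretch of the cycle after \<open>i\<close> up to \<open>j\<close> is closed under the new permutation.\<close>
  define X where "X = (\<lambda>s. (\<sigma> ^^ s) i) ` {0<..t}"
  have i: "i \<notin> X"
  proof
    assume "i \<in> X"
    then obtain s where s: "0 < s" "s \<le> t" "(\<sigma> ^^ s) i = i" by (auto simp: X_def)
    then have "s < t" using t ij by (metis le_neq_implies_less)
    then have "(\<sigma> ^^ (t - s)) i = j" using t s funpow_add[of "t - s" s \<sigma>] by simp
    then show False using least[of "t - s"] s \<open>s < t\<close> by simp
  qed
  have "orbit \<tau> j \<subseteq> X"
  proof (rule orbit_least)
    show "j \<in> X" using t by (auto simp: X_def)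
    fix y assume y: "y \<in> X"
    then obtain s where s: "0 < s" "s \<le> t" "y = (\<sigma> ^^ s) i" by (auto simp: X_def)
    show "\<tau> y \<in> X"
    proof (cases "s = t")
      case True
      then have "\<tau> y = (\<sigma> ^^ 1) i" using s t by (simp add: \<tau>_def)
      then show ?thesis using t unfolding X_def by (intro image_eqI[of _ _ 1]) auto
    next
      case False
      then have "y \<noteq> j" "y \<noteq> i" using s y i least by auto
      then have "\<tau> y = (\<sigma> ^^ Suc s) i" using s by (simp add: \<tau>_def)
      then show ?thesis using s False unfolding X_def by (intro image_eqI[of _ _ "Suc s"]) auto
    qed
  qed
  then have "i \<notin> orbit \<tau> j" using i by auto
  then show ?thesis using orbit_eq[OF \<tau>] permutation_self_in_orbit[OF \<tau>] unfolding \<tau>_def by metis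
qed

lemma permutes_permutation: "\<sigma> permutes {..<k::nat} \<Longrightarrow> permutation \<sigma>"
  using permutation_permutes by blast

lemma finite_cycles [simp]: "finite (cycles k \<sigma>)"
  by (simp add: cycles_def)

lemma cycle_eq_orbit:
  assumes "\<sigma> permutes {..<k}" "c \<in> cycles k \<sigma>" "x \<in> c"
  shows "c = orbit \<sigma> x"
proof -
  obtain y where "c = orbit \<sigma> y" using assms(2) by (auto simp: cycles_def)
  then show ?thesis using assms(3) orbit_eq[OF permutes_permutation[OF assms(1)], of x y] by simp
qed

lemma cycle_subset: "\<sigma> permutes {..<k} \<Longrightarrow> c \<in> cycles k \<sigma> \<Longrightarrow> c \<subseteq> {..<k}"
  using permutes_orbit_subset[of \<sigma> "{..<k}"] by (auto simp: cycles_def)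

lemma partition_on_cycles:
  assumes "\<sigma> permutes {..<k}"
  shows "partition_on {..<k} (cycles k \<sigma>)"
proof (rule partition_onI)
  note p = permutes_permutation[OF assms]
  show "\<Union> (cycles k \<sigma>) = {..<k}"
    using permutes_orbit_subset[OF assms] permutation_self_in_orbit[OF p]
    by (auto simp: cycles_def)
  show "{} \<notin> cycles k \<sigma>" using orbit_nonempty[of \<sigma>] by (force simp: cycles_def)
  show "disjnt c d" if "c \<in> cycles k \<sigma>" "d \<in> cycles k \<sigma>" "c \<noteq> d" for c d
    using that cycle_eq_orbit[OF assms] unfolding disjnt_def by blast
qed

lemma cycles_comp_transpose_merge:
  assumes \<sigma>: "\<sigma> permutes {..<k}" and i: "i < k" and j: "j \<notin> orbit \<sigma> i"
  shows "cycles k (\<sigma> \<circ> transpose i j) =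
    insert (orbit \<sigma> i \<union> orbit \<sigma> j) (cycles k \<sigma> - {orbit \<sigma> i, orbit \<sigma> j})"
proof -
  note p = permutes_permutation[OF \<sigma>]
  note o = orbit_comp_transpose_merge[OF p j]
  have self: "x \<in> orbit \<sigma> x" for x using permutation_self_in_orbit[OF p] .
  have *: "x \<notin> orbit \<sigma> i \<union> orbit \<sigma> j \<longleftrightarrow> orbit \<sigma> x \<notin> {orbit \<sigma> i, orbit \<sigma> j}" for x
    using orbit_eq[OF p] self by blast
  show ?thesis
  proof (intro equalityI subsetI)
    fix c assume "c \<in> cycles k (\<sigma> \<circ> transpose i j)"
    then obtain x where x: "x < k" "c = orbit (\<sigma> \<circ> transpose i j) x" by (auto simp: cycles_def)
    then show "c \<in> insert (orbit \<sigma> i \<union> orbit \<sigma> j) (cycles k \<sigma> - {orbit \<sigma> i, orbit \<sigma> j})"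
      using o[of x] *[of x] by (auto simp: cycles_def split: if_splits)
  next
    fix c assume "c \<in> insert (orbit \<sigma> i \<union> orbit \<sigma> j) (cycles k \<sigma> - {orbit \<sigma> i, orbit \<sigma> j})"
    then consider "c = orbit \<sigma> i \<union> orbit \<sigma> j"
      | x where "x < k" "c = orbit \<sigma> x" "c \<notin> {orbit \<sigma> i, orbit \<sigma> j}"
      by (auto simp: cycles_def)
    then show "c \<in> cycles k (\<sigma> \<circ> transpose i j)"
    proof cases
      case 1
      then show ?thesis using o[of i] self i unfolding cycles_def by (intro image_eqI[of _ _ i]) auto
    next
      case 2
      then show ?thesis using o[of x] *[of x] unfolding cycles_def by (intro image_eqI[of _ _ x]) auto
    qed
  qed
qed

lemma card_cycles_merge:
  assumes \<sigma>: "\<sigma> permutes {..<k}" and i: "i < k" and jk: "j < k" and j: "j \<notin> orbit \<sigma> i"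
  shows "Suc (card (cycles k (\<sigma> \<circ> transpose i j))) = card (cycles k \<sigma>)"
proof -
  note p = permutes_permutation[OF \<sigma>]
  have self: "x \<in> orbit \<sigma> x" for x using permutation_self_in_orbit[OF p] .
  let ?A = "orbit \<sigma> i" and ?B = "orbit \<sigma> j"
  have ne: "?A \<noteq> ?B" using j self by auto
  have AB: "?A \<in> cycles k \<sigma>" "?B \<in> cycles k \<sigma>" using i jk by (auto simp: cycles_def)
  have "?A \<union> ?B \<notin> cycles k \<sigma>"
  proof
    assume "?A \<union> ?B \<in> cycles k \<sigma>"
    then obtain x where "?A \<union> ?B = orbit \<sigma> x" by (auto simp: cycles_def)
    then have "?A = orbit \<sigma> x" "?B = orbit \<sigma> x" using orbit_eq[OF p] self by blast+
    with ne show False by simp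
  qed
  then have "card (cycles k (\<sigma> \<circ> transpose i j)) = Suc (card (cycles k \<sigma> - {?A, ?B}))"
    unfolding cycles_comp_transpose_merge[OF \<sigma> i j] by simp
  moreover have "card (cycles k \<sigma> - {?A, ?B}) = card (cycles k \<sigma>) - 2"
    using AB ne by (subst card_Diff_subset) auto
  moreover have "card {?A, ?B} \<le> card (cycles k \<sigma>)" using AB by (intro card_mono) auto
  ultimately show ?thesis using ne by simp
qed

lemma transpose_permutes: "i < k \<Longrightarrow> j < k \<Longrightarrow> transpose i j permutes {..<k::nat}"
  by (rule permutes_swap_id) auto

lemma card_cycles_split:
  assumes \<sigma>: "\<sigma> permutes {..<k}" and i: "i < k" and jk: "j < k"
    and j: "j \<in> orbit \<sigma> i" and ij: "i \<noteq> j"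
  shows "card (cycles k (\<sigma> \<circ> transpose i j)) = Suc (card (cycles k \<sigma>))"
proof -
  let ?\<tau> = "\<sigma> \<circ> transpose i j"
  have "?\<tau> permutes {..<k}" using transpose_permutes[OF i jk] \<sigma> by (rule permutes_compose)
  from card_cycles_merge[OF this i jk orbit_comp_transpose_split[OF permutes_permutation[OF \<sigma>] j ij]]
  show ?thesis by (simp add: comp_assoc)
qed

lemma cycles_inv: "\<sigma> permutes {..<k} \<Longrightarrow> cycles k (inv \<sigma>) = cycles k \<sigma>"
  using orbit_inv_eq[OF permutes_permutation] by (simp add: cycles_def)

lemma inv_transpose_comp:
  assumes "\<sigma> permutes {..<k}"
  shows "inv (transpose i j \<circ> \<sigma>) = inv \<sigma> \<circ> transpose i j"
  using permutes_bij[OF assms] by (subst o_inv_distrib) auto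

text \<open>
  A permutation and its inverse have the same cycles, so multiplication by a transposition from the
  left behaves like multiplication from the right.
\<close>

lemma card_cycles_split_left:
  assumes \<sigma>: "\<sigma> permutes {..<k}" and "i < k" "j < k" "j \<in> orbit \<sigma> i" "i \<noteq> j"
  shows "card (cycles k (transpose i j \<circ> \<sigma>)) = Suc (card (cycles k \<sigma>))"
proof -
  have "transpose i j \<circ> \<sigma> permutes {..<k}"
    using \<sigma> transpose_permutes[OF assms(2,3)] by (rule permutes_compose)
  then have "cycles k (transpose i j \<circ> \<sigma>) = cycles k (inv \<sigma> \<circ> transpose i j)"
    by (metis cycles_inv inv_transpose_comp[OF \<sigma>])
  then show ?thesis
    using card_cycles_split[OF permutes_inv[OF \<sigma>] assms(2,3)] assms(4,5)
    by (simp add: orbit_inv_eq[OF permutes_permutation[OF \<sigma>]] cycles_inv[OF \<sigma>])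
qed

section \<open>The interval below a permutation\<close>

lemma card_cycles_id: "card (cycles k id) = k"
proof -
  have "cycles k (id :: nat \<Rightarrow> nat) = (\<lambda>x. {x}) ` {..<k}"
    unfolding cycles_def by (intro image_cong refl) (simp add: orbit_eq_singleton_iff)
  then show ?thesis by (simp add: card_image inj_on_def)
qed

text \<open>
  This is the triangle inequality for the length \<open>k - card (cycles k \<sigma>)\<close>, with a consequence of
  equality. A transposition \<open>(i j)\<close> that makes \<open>j\<close> a fixed point of \<open>\<beta>\<close> is moved over to \<open>\<alpha>\<close>. This
  gains one cycle in the second factor and gains or loses one in the first; equality forces a loss,
  so that two cycles of \<open>\<alpha>\<close> are merged, and the new first factor has coarser cycles than \<open>\<alpha>\<close>.
\<close>

lemma card_cycles_comp_le:
  assumes "\<alpha> permutes {..<k}" "\<beta> permutes {..<k}"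
  shows "card (cycles k \<alpha>) + card (cycles k \<beta>) \<le> k + card (cycles k (\<alpha> \<circ> \<beta>)) \<and>
    (card (cycles k \<alpha>) + card (cycles k \<beta>) = k + card (cycles k (\<alpha> \<circ> \<beta>)) \<longrightarrow>
      (\<forall>x. orbit \<alpha> x \<subseteq> orbit (\<alpha> \<circ> \<beta>) x))"
  using assms
proof (induction "k - card (cycles k \<beta>)" arbitrary: \<alpha> \<beta> rule: less_induct)
  case less
  note \<alpha> = less.prems(1) and \<beta> = less.prems(2)
  have card_le: "card (cycles k \<sigma>) \<le> k" for \<sigma>
    unfolding cycles_def using card_image_le[of "{..<k}" "orbit \<sigma>"] by simp
  show ?case
  proof (cases "\<beta> = id")
    case True
    then show ?thesis by (simp add: card_cycles_id)
  next
    case False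
    then obtain i where i: "\<beta> i \<noteq> i" by (auto simp: fun_eq_iff)
    define j where "j = inv \<beta> i"
    have ik: "i < k" using i \<beta> by (auto dest: permutes_not_in)
    have bj: "\<beta> j = i" unfolding j_def using \<beta> by (simp add: permutes_inverses)
    then have ij: "i \<noteq> j" and jk: "j < k" using i ik \<beta> permutes_in_image[OF \<beta>, of j] by auto
    let ?t = "transpose i j"
    \<comment> \<open>The predecessor \<open>j\<close> of \<open>i\<close> is sent to \<open>i\<close> by \<open>\<beta>\<close>; after the exchange \<open>j\<close> is a fixed point.\<close>
    define \<beta>' where "\<beta>' = ?t \<circ> \<beta>"
    have \<alpha>': "\<alpha> \<circ> ?t permutes {..<k}" using transpose_permutes[OF ik jk] \<alpha> by (rule permutes_compose)
    have \<beta>': "\<beta>' permutes {..<k}" unfolding \<beta>'_def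
      using \<beta> transpose_permutes[OF ik jk] by (rule permutes_compose)
    note p = permutes_permutation
    have "j \<in> orbit \<beta> i" using bj orbit.base[of \<beta> j] orbit_eq[OF p[OF \<beta>]]
      permutation_self_in_orbit[OF p[OF \<beta>]] by metis
    then have c\<beta>: "card (cycles k \<beta>') = Suc (card (cycles k \<beta>))"
      unfolding \<beta>'_def by (intro card_cycles_split_left \<beta> ik jk ij)
    have eq: "(\<alpha> \<circ> ?t) \<circ> \<beta>' = \<alpha> \<circ> \<beta>" by (simp add: \<beta>'_def fun_eq_iff)
    have "k - card (cycles k \<beta>') < k - card (cycles k \<beta>)"
      using c\<beta> card_le[of \<beta>'] by simp
    note IH = less.hyps[OF this \<alpha>' \<beta>', unfolded eq]
    show ?thesis
    proof (cases "j \<in> orbit \<alpha> i")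
      case True
      then have "card (cycles k (\<alpha> \<circ> ?t)) = Suc (card (cycles k \<alpha>))"
        using card_cycles_split[OF \<alpha> ik jk] ij by simp
      then show ?thesis using IH c\<beta> by simp
    next
      case False
      then have c\<alpha>: "Suc (card (cycles k (\<alpha> \<circ> ?t))) = card (cycles k \<alpha>)"
        using card_cycles_merge[OF \<alpha> ik jk] by simp
      have "orbit \<alpha> x \<subseteq> orbit (\<alpha> \<circ> ?t) x" for x
        using orbit_eq[OF p[OF \<alpha>]] by (auto simp: orbit_comp_transpose_merge[OF p[OF \<alpha>] False])
      then show ?thesis using IH c\<alpha> c\<beta> by fastforce
    qed
  qed
qed

text \<open>
  This is the interval from the identity to \<open>\<sigma>\<close> in the Cayley graph of the symmetric group
  generated by all transpositions: in terms of lengths, the equation says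
  \<open>|\<tau>| + |\<tau>\<^sup>-\<^sup>1 \<sigma>| = |\<sigma>|\<close>. On permutation diagrams it is the order \<open>diagram_le\<close>
  (\<open>diagram_le_perm_diagrams\<close>).
\<close>

definition perms_below :: "nat \<Rightarrow> (nat \<Rightarrow> nat) \<Rightarrow> (nat \<Rightarrow> nat) set" where
  "perms_below k \<sigma> = {\<tau>. \<tau> permutes {..<k} \<and>
     card (cycles k \<tau>) + card (cycles k (inv \<tau> \<circ> \<sigma>)) = k + card (cycles k \<sigma>)}"

lemma finite_perms_below [simp]: "finite (perms_below k \<sigma>)"
  by (rule finite_subset[OF _ finite_permutations[of "{..<k}"]]) (auto simp: perms_below_def)

lemma perms_below_permutes: "\<tau> \<in> perms_below k \<sigma> \<Longrightarrow> \<tau> permutes {..<k}"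
  by (simp add: perms_below_def)

lemma self_below: "\<sigma> permutes {..<k} \<Longrightarrow> \<sigma> \<in> perms_below k \<sigma>"
  by (simp add: perms_below_def permutes_inv_o card_cycles_id)

lemma inv_comp_cancel: "\<tau> permutes S \<Longrightarrow> \<tau> \<circ> (inv \<tau> \<circ> \<sigma>) = \<sigma>"
  by (simp add: fun_eq_iff permutes_inverses)

lemma perms_below_refines:
  assumes \<sigma>: "\<sigma> permutes {..<k}" and \<tau>: "\<tau> \<in> perms_below k \<sigma>"
  shows "orbit \<tau> x \<subseteq> orbit \<sigma> x"
proof -
  have p: "\<tau> permutes {..<k}" "inv \<tau> \<circ> \<sigma> permutes {..<k}"
    using \<tau> \<sigma> permutes_compose[OF \<sigma> permutes_inv] by (auto simp: perms_below_def)
  from card_cycles_comp_le[OF this] \<tau> show ?thesis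
    by (simp add: inv_comp_cancel[OF p(1)] perms_below_def)
qed

section \<open>Permutations below a long cycle are non-crossing partitions\<close>

definition long_cycle :: "nat \<Rightarrow> nat \<Rightarrow> nat" where
  "long_cycle n = cycle_of_list [0..<n]"

lemma long_cycle_apply: "long_cycle n x = (if Suc x < n then Suc x else if x < n then 0 else x)"
proof (cases "x < n")
  case True
  have "map (long_cycle n) [0..<n] = rotate1 [0..<n]"
    unfolding long_cycle_def using cyclic_rotation[of "[0..<n]" 1] by simp
  then have "map (long_cycle n) [0..<n] ! x = rotate1 [0..<n] ! x" by simp
  then have "long_cycle n x = [0..<n] ! (Suc x mod n)" using True by (simp add: nth_rotate1)
  moreover have "Suc x mod n = (if Suc x < n then Suc x else 0)"
    using True by (cases "Suc x = n") auto
  ultimately show ?thesis using True by simp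
next
  case False
  then show ?thesis by (simp add: long_cycle_def id_outside_supp)
qed

lemma long_cycle_permutes: "long_cycle n permutes {..<n}"
  using cycle_permutes[of "[0..<n]"] by (simp add: long_cycle_def atLeast0LessThan)

lemma orbit_long_cycle: "x < n \<Longrightarrow> orbit (long_cycle n) x = {..<n}"
proof -
  assume x: "x < n"
  note p = permutes_permutation[OF long_cycle_permutes[of n]]
  have "y \<in> orbit (long_cycle n) 0" if "y < n" for y
    using that
  proof (induction y)
    case 0
    show ?case by (rule permutation_self_in_orbit[OF p])
  next
    case (Suc y)
    then have "Suc y = long_cycle n y" by (simp add: long_cycle_apply)
    with Suc show ?case using orbit.step[of y "long_cycle n" 0] by simp
  qed
  then have "{..<n} \<subseteq> orbit (long_cycle n) 0" by auto
  moreover have "orbit (long_cycle n) 0 \<subseteq> {..<n}"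
    using permutes_orbit_subset[OF long_cycle_permutes] x by auto
  ultimately show ?thesis using orbit_eq[OF p] x by auto
qed

lemma cycles_long_cycle: "cycles n (long_cycle n) = (if n = 0 then {} else {{..<n}})"
  using orbit_long_cycle[of _ n] by (auto simp: cycles_def image_def)

text \<open>
  Multiplication by \<open>(x y)\<close> from the left adds one cycle to \<open>\<tau>\<close> and one to the long cycle, and does
  not change \<open>\<tau>\<^sup>-\<^sup>1\<close> times the long cycle. Hence \<open>(x y) \<tau>\<close> lies below the product of \<open>(x y)\<close> and the
  long cycle, whose two cycles are the arc \<open>{x..<y}\<close> and its complement, and its cycles refine them.
\<close>

lemma perms_below_long_cycle_arcs:
  assumes \<tau>: "\<tau> \<in> perms_below n (long_cycle n)"
    and xy: "x < y" "y < n" "y \<in> orbit \<tau> x"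
    and w: "w \<in> orbit (transpose x y \<circ> \<tau>) z"
  shows "w \<in> {x..<y} \<longleftrightarrow> z \<in> {x..<y}"
proof -
  let ?t = "transpose x y" and ?\<gamma> = "long_cycle n"
  have \<tau>p: "\<tau> permutes {..<n}" using \<tau> by (rule perms_below_permutes)
  have t: "?t permutes {..<n}" using xy by (intro transpose_permutes) auto
  have t\<gamma>: "?t \<circ> ?\<gamma> permutes {..<n}" using long_cycle_permutes t by (rule permutes_compose)
  have t\<tau>: "?t \<circ> \<tau> permutes {..<n}" using \<tau>p t by (rule permutes_compose)
  have 1: "card (cycles n (?t \<circ> \<tau>)) = Suc (card (cycles n \<tau>))"
    using xy by (intro card_cycles_split_left \<tau>p) auto
  have 2: "card (cycles n (?t \<circ> ?\<gamma>)) = Suc (card (cycles n ?\<gamma>))"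
    using xy by (intro card_cycles_split_left long_cycle_permutes) (auto simp: orbit_long_cycle)
  have 3: "inv (?t \<circ> \<tau>) \<circ> (?t \<circ> ?\<gamma>) = inv \<tau> \<circ> ?\<gamma>"
    unfolding inv_transpose_comp[OF \<tau>p] by (simp add: fun_eq_iff)
  have "?t \<circ> \<tau> \<in> perms_below n (?t \<circ> ?\<gamma>)"
    using \<tau> 1 2 t\<tau> by (simp add: perms_below_def 3)
  then have w': "w \<in> orbit (?t \<circ> ?\<gamma>) z" using perms_below_refines[OF t\<gamma>] w by blast
  have step: "(?t \<circ> ?\<gamma>) v \<in> {x..<y} \<longleftrightarrow> v \<in> {x..<y}" for v
    using xy by (auto simp: long_cycle_apply transpose_def)
  from w' show ?thesis by induction (use step in auto)
qed

text \<open>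
  Let \<open>h\<close> and \<open>j\<close> lie in one cycle. A different cycle is not changed by the transposition of \<open>h\<close> and
  \<open>j\<close>, so it lies on one side of the arc \<open>{h..<j}\<close>.
\<close>

lemma noncrossing_cycles:
  assumes \<tau>: "\<tau> \<in> perms_below n (long_cycle n)"
  shows "cycles n \<tau> \<in> NC n"
proof -
  have \<tau>p: "\<tau> permutes {..<n}" using \<tau> by (rule perms_below_permutes)
  note p = permutes_permutation[OF \<tau>p]
  have False if b: "b \<in> cycles n \<tau>" and c: "c \<in> cycles n \<tau>" and "b \<noteq> c"
    and lt: "h < i" "i < j" "j < l" and "h \<in> b" "j \<in> b" "i \<in> c" "l \<in> c" for b c h i j l
  proof -
    have bc: "b = orbit \<tau> h" "c = orbit \<tau> i"
      using that by (auto intro!: cycle_eq_orbit[OF \<tau>p])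
    have "j < n" using cycle_subset[OF \<tau>p b] \<open>j \<in> b\<close> by auto
    have "orbit (transpose h j \<circ> \<tau>) i = orbit \<tau> i"
    proof (rule orbit_cong[OF permutation_self_in_orbit[OF p]])
      fix s assume "s \<in> orbit \<tau> i"
      then have "\<tau> s \<in> c" using bc by (auto intro: orbit.step)
      moreover have "h \<notin> c" "j \<notin> c"
        using that cycle_eq_orbit[OF \<tau>p b] cycle_eq_orbit[OF \<tau>p c] by metis+
      ultimately show "(transpose h j \<circ> \<tau>) s = \<tau> s" by (auto simp: transpose_def)
    qed
    then have "l \<in> orbit (transpose h j \<circ> \<tau>) i" using that bc by simp
    with perms_below_long_cycle_arcs[OF \<tau>, of h j l i] lt \<open>j < n\<close> \<open>j \<in> b\<close> bc show False by auto
  qed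
  then show ?thesis using partition_on_cycles[OF \<tau>p] unfolding NC_def noncrossing_def by blast
qed

text \<open>
  The rest of the cycle of \<open>x\<close> has to lie on one side of the arc between \<open>x\<close> and \<open>\<tau> x\<close>. So a cycle
  jumps upwards to its next larger element, and downwards only from its maximum to its minimum.
\<close>

lemma increasing_cycles:
  assumes \<tau>: "\<tau> \<in> perms_below n (long_cycle n)" and x: "x < n" and z: "z \<in> orbit \<tau> x"
  shows "x < \<tau> x \<Longrightarrow> z \<le> x \<or> \<tau> x \<le> z"
    and "\<tau> x \<le> x \<Longrightarrow> \<tau> x \<le> z \<and> z \<le> x"
proof -
  have \<tau>p: "\<tau> permutes {..<n}" using \<tau> by (rule perms_below_permutes)
  note p = permutes_permutation[OF \<tau>p]
  define y where "y = \<tau> x"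
  have y: "y < n" unfolding y_def using permutes_in_image[OF \<tau>p] x by auto
  have o: "y \<in> orbit \<tau> x" "x \<in> orbit \<tau> y"
    using orbit.base[of \<tau> x] permutation_self_in_orbit[OF p, of x] orbit_eq[OF p, of y x]
    by (auto simp: y_def)
  \<comment> \<open>Composing with the transposition of \<open>x\<close> and \<open>\<tau> x\<close> makes \<open>x\<close> a fixed point and
    leaves the rest of its cycle in one piece.\<close>
  have "transpose x y \<circ> \<tau> permutes {..<n}"
    using \<tau>p transpose_permutes[OF x y] by (rule permutes_compose)
  note p' = permutation_self_in_orbit[OF permutes_permutation[OF this]]
  have *: "z = x \<or> z \<in> orbit (transpose x y \<circ> \<tau>) y"
    using z
  proof induction
    case base
    show ?case using p'[of y] unfolding y_def by blast
  next
    case (step z)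
    show ?case
    proof (cases "\<tau> z = x \<or> \<tau> z = y")
      case True
      then show ?thesis using p'[of y] by metis
    next
      case False
      then have "(transpose x y \<circ> \<tau>) z = \<tau> z" "z \<noteq> x" by (auto simp: transpose_def y_def)
      then show ?thesis using step.IH by (metis orbit.step)
    qed
  qed
  show "z \<le> x \<or> \<tau> x \<le> z" if "x < \<tau> x"
    using * perms_below_long_cycle_arcs[OF \<tau>, of x y z y] that y o by (auto simp: y_def)
  show "\<tau> x \<le> z \<and> z \<le> x" if "\<tau> x \<le> x"
  proof (cases "\<tau> x = x")
    case True
    then have "orbit \<tau> x = {x}" by (simp add: orbit_eq_singleton_iff)
    then show ?thesis using z True by simp
  next
    case False
    then show ?thesis
      using * perms_below_long_cycle_arcs[OF \<tau>, of y x z y] that x o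
      by (auto simp: y_def transpose_commute)
  qed
qed

lemma noncrossingD:
  assumes "noncrossing \<pi>" "b \<in> \<pi>" "c \<in> \<pi>" "h \<in> b" "i \<in> c" "j \<in> b" "l \<in> c" "h < i" "i < j" "j < l"
  shows "b = c"
proof (rule ccontr)
  assume "b \<noteq> c"
  with assms(4-) have "\<exists>h i j l. h < i \<and> i < j \<and> j < l \<and> h \<in> b \<and> j \<in> b \<and> i \<in> c \<and> l \<in> c"
    by (intro exI[of _ h] exI[of _ i] exI[of _ j] exI[of _ l] conjI)
  with \<open>b \<noteq> c\<close> assms(2,3) have "\<not> noncrossing \<pi>"
    unfolding noncrossing_def not_not by (intro bexI[of _ b] bexI[of _ c] conjI)
  with assms(1) show False by simp
qed

lemma cycles_Suc:
  assumes "\<tau> permutes {..<n}"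
  shows "cycles (Suc n) \<tau> = insert {n} (cycles n \<tau>)"
    and "card (cycles (Suc n) \<tau>) = Suc (card (cycles n \<tau>))"
    and "orbit \<tau> n = {n}"
proof -
  show o: "orbit \<tau> n = {n}" using permutes_not_in[OF assms] by (simp add: orbit_eq_singleton_iff)
  then show c: "cycles (Suc n) \<tau> = insert {n} (cycles n \<tau>)"
    by (simp add: cycles_def lessThan_Suc)
  have "{n} \<notin> cycles n \<tau>" using cycle_subset[OF assms] by force
  then show "card (cycles (Suc n) \<tau>) = Suc (card (cycles n \<tau>))" by (simp add: c)
qed

lemma permutes_lessThan_Suc: "\<tau> permutes {..<n} \<Longrightarrow> \<tau> permutes {..<Suc n}"
  by (rule permutes_subset) auto

lemma long_cycle_Suc: "0 < n \<Longrightarrow> long_cycle (Suc n) = long_cycle n \<circ> transpose n (n - 1)"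
  by (auto simp: fun_eq_iff long_cycle_apply transpose_def)

text \<open>
  Here \<open>n\<close> is a fixed point of \<open>\<rho>\<close>, and composing with the transposition inserts it into the cycle of
  \<open>i\<close>, between \<open>i\<close> and its image.
\<close>

lemma card_cycles_append:
  assumes \<rho>: "\<rho> permutes {..<n}" and i: "i < n"
  shows "card (cycles (Suc n) (\<rho> \<circ> transpose n i)) = card (cycles n \<rho>)"
    and "orbit (\<rho> \<circ> transpose n i) n = insert n (orbit \<rho> i)"
proof -
  note \<rho>' = permutes_lessThan_Suc[OF \<rho>]
  have i': "i \<notin> orbit \<rho> n" using i cycles_Suc(3)[OF \<rho>] by simp
  show "card (cycles (Suc n) (\<rho> \<circ> transpose n i)) = card (cycles n \<rho>)"
    using card_cycles_merge[OF \<rho>' _ _ i'] i cycles_Suc(2)[OF \<rho>] by simp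
  show "orbit (\<rho> \<circ> transpose n i) n = insert n (orbit \<rho> i)"
    using orbit_comp_transpose_merge[OF permutes_permutation[OF \<rho>] i', of n] cycles_Suc(3)[OF \<rho>]
    by simp
qed

lemma perms_below_fix_last:
  assumes \<tau>: "\<tau> \<in> perms_below n (long_cycle n)"
  shows "\<tau> \<in> perms_below (Suc n) (long_cycle (Suc n))"
proof (cases "n = 0")
  case True
  then have "\<tau> = id" using \<tau> by (auto simp: perms_below_def)
  moreover have "long_cycle (Suc 0) = id" by (auto simp: fun_eq_iff long_cycle_apply)
  ultimately show ?thesis using True by (simp add: perms_below_def permutes_id cycles_Suc(2) cycles_def lessThan_Suc)
next
  case False
  have \<tau>p: "\<tau> permutes {..<n}" using \<tau> by (rule perms_below_permutes)
  have \<rho>: "inv \<tau> \<circ> long_cycle n permutes {..<n}"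
    by (rule permutes_compose[OF long_cycle_permutes permutes_inv[OF \<tau>p]])
  have "card (cycles (Suc n) (inv \<tau> \<circ> long_cycle (Suc n))) = card (cycles n (inv \<tau> \<circ> long_cycle n))"
    using card_cycles_append(1)[OF \<rho>, of "n - 1"] False by (simp add: long_cycle_Suc comp_assoc)
  then show ?thesis
    using \<tau> False permutes_lessThan_Suc[OF \<tau>p] cycles_Suc(2)[OF \<tau>p]
    by (simp add: perms_below_def cycles_long_cycle)
qed

text \<open>
  Inserting \<open>n\<close> into a cycle of \<open>\<tau>\<close> does not change the number of cycles. So the permutation
  \<open>\<tau>\<^sup>-\<^sup>1 \<circ> long_cycle n\<close> has to gain one: it first receives \<open>n\<close> in the cycle of \<open>n - 1\<close>, which is then
  split by \<open>(n i)\<close> if it contains \<open>i\<close>.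
\<close>

lemma perms_below_append_last:
  assumes \<tau>: "\<tau> \<in> perms_below n (long_cycle n)" and n: "0 < n"
    and i: "i \<in> orbit (inv \<tau> \<circ> long_cycle n) (n - 1)"
  shows "\<tau> \<circ> transpose n i \<in> perms_below (Suc n) (long_cycle (Suc n))"
proof -
  have \<tau>p: "\<tau> permutes {..<n}" using \<tau> by (rule perms_below_permutes)
  define \<rho> where "\<rho> = inv \<tau> \<circ> long_cycle n"
  have \<rho>: "\<rho> permutes {..<n}" unfolding \<rho>_def
    by (rule permutes_compose[OF long_cycle_permutes permutes_inv[OF \<tau>p]])
  have iln: "i < n" using permutes_orbit_subset[OF \<rho>, of "n - 1"] n i by (auto simp: \<rho>_def)
  have t: "transpose n i permutes {..<Suc n}" using iln by (intro transpose_permutes) auto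
  define \<rho>' where "\<rho>' = \<rho> \<circ> transpose n (n - 1)"
  have \<rho>': "\<rho>' permutes {..<Suc n}" unfolding \<rho>'_def
    using n by (intro permutes_compose transpose_permutes permutes_lessThan_Suc[OF \<rho>]) auto
  have "inv (\<tau> \<circ> transpose n i) \<circ> long_cycle (Suc n) = transpose n i \<circ> \<rho>'"
    using permutes_bij[OF \<tau>p] n
    by (simp add: o_inv_distrib \<rho>'_def \<rho>_def long_cycle_Suc comp_assoc)
  moreover have "card (cycles (Suc n) (transpose n i \<circ> \<rho>')) = Suc (card (cycles (Suc n) \<rho>'))"
  proof (rule card_cycles_split_left[OF \<rho>'])
    show "i \<in> orbit \<rho>' n"
      using card_cycles_append(2)[OF \<rho>, of "n - 1"] n i by (simp add: \<rho>'_def \<rho>_def)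
  qed (use iln in auto)
  moreover have "card (cycles (Suc n) \<rho>') = card (cycles n \<rho>)"
    using card_cycles_append(1)[OF \<rho>, of "n - 1"] n by (simp add: \<rho>'_def)
  moreover have "card (cycles (Suc n) (\<tau> \<circ> transpose n i)) = card (cycles n \<tau>)"
    by (rule card_cycles_append(1)[OF \<tau>p iln])
  moreover have "\<tau> \<circ> transpose n i permutes {..<Suc n}"
    using t permutes_lessThan_Suc[OF \<tau>p] by (rule permutes_compose)
  ultimately show ?thesis
    using \<tau> n by (simp add: perms_below_def cycles_long_cycle \<rho>_def)
qed

text \<open>
  The maximum \<open>i\<close> of a block that is not nested inside another block satisfies the hypothesis of
  \<open>perms_below_append_last\<close>. For \<open>i = n - 1\<close> this is clear. Otherwise \<open>\<tau>\<^sup>-\<^sup>1 \<circ> long_cycle n\<close> maps \<open>i\<close> to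
  the predecessor of \<open>i + 1\<close> in its cycle; as the block of \<open>i\<close> is outer, \<open>i + 1\<close> is the minimum of its
  block, so that this predecessor is the maximum of the next outer block to the right.
\<close>

lemma outer_maximum_reachable:
  assumes \<tau>: "\<tau> \<in> perms_below n (long_cycle n)"
    and "i < n" "\<tau> i \<le> i" "\<And>h j. h < i \<Longrightarrow> i < j \<Longrightarrow> j < n \<Longrightarrow> j \<notin> orbit \<tau> h"
  shows "i \<in> orbit (inv \<tau> \<circ> long_cycle n) (n - 1)"
  using assms(2-4)
proof (induction "n - i" arbitrary: i rule: less_induct)
  case less
  note i = less.prems
  have \<tau>p: "\<tau> permutes {..<n}" using \<tau> by (rule perms_below_permutes)
  note p = permutes_permutation[OF \<tau>p]
  \<comment> \<open>This permutation is the Kreweras complement of \<open>\<tau>\<close>.\<close>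
  define \<rho> where "\<rho> = inv \<tau> \<circ> long_cycle n"
  have "\<rho> permutes {..<n}" unfolding \<rho>_def
    by (rule permutes_compose[OF long_cycle_permutes permutes_inv[OF \<tau>p]])
  note \<rho> = permutes_permutation[OF this]
  show ?case
  proof (cases "Suc i = n")
    case True
    then show ?thesis using permutation_self_in_orbit[OF \<rho>, of i] by (auto simp: \<rho>_def)
  next
    case False
    then have Si: "Suc i < n" using i by simp
    define l where "l = inv \<tau> (Suc i)"
    have \<tau>l: "\<tau> l = Suc i" unfolding l_def using \<tau>p by (simp add: permutes_inverses)
    then have l: "l < n" using permutes_in_image[OF \<tau>p, of l] Si by simp
    have \<rho>i: "\<rho> i = l" using Si by (simp add: \<rho>_def l_def long_cycle_apply)
    have Sil: "Suc i \<in> orbit \<tau> l" using \<tau>l orbit.base[of \<tau> l] by simp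
    have il: "Suc i \<le> l"
    proof (rule ccontr)
      assume "\<not> Suc i \<le> l"
      moreover have "l \<noteq> i" using \<tau>l i(2) by auto
      ultimately have "l < i" by simp
      then show False using i(3)[of l "Suc i"] Si Sil by simp
    qed
    have max_l: "z \<le> l" if "z \<in> orbit \<tau> l" for z
      using increasing_cycles(2)[OF \<tau> l that] \<tau>l il by simp
    have outer: "j \<notin> orbit \<tau> h" if "h < l" "l < j" "j < n" for h j
    proof
      assume j: "j \<in> orbit \<tau> h"
      consider "h < i" | "h = i" | "h = Suc i" | "Suc i < h" by linarith
      then show False
      proof cases
        case 1
        then show ?thesis using i(3)[of h j] j il that by simp
      next
        case 2
        then show ?thesis using increasing_cycles(2)[OF \<tau> i(1), of j] j i(2) il that by simp
      next
        case 3
        then have "j \<in> orbit \<tau> l" using j Sil orbit_eq[OF p Sil] by simp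
        then show ?thesis using max_l that by force
      next
        case 4
        have "orbit \<tau> l \<in> cycles n \<tau>" "orbit \<tau> h \<in> cycles n \<tau>"
          using l that by (auto simp: cycles_def)
        moreover have "noncrossing (cycles n \<tau>)" using noncrossing_cycles[OF \<tau>] by (simp add: NC_def)
        ultimately have "orbit \<tau> l = orbit \<tau> h"
          using 4 that Sil j permutation_self_in_orbit[OF p]
          by (intro noncrossingD[of "cycles n \<tau>" _ _ "Suc i" h l j]) auto
        then show ?thesis using max_l[of j] j that by simp
      qed
    qed
    have "n - l < n - i" using il l by simp
    then have "l \<in> orbit \<rho> (n - 1)"
      unfolding \<rho>_def using l il \<tau>l outer by (intro less.hyps) auto
    moreover have "orbit \<rho> l = orbit \<rho> i"
      using permutation_orbit_step[OF \<rho>, of i] by (simp add: \<rho>i)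
    ultimately show ?thesis
      using permutation_self_in_orbit[OF \<rho>, of i] orbit_eq[OF \<rho>, of l "n - 1"] by (simp add: \<rho>_def)
  qed
qed

text \<open>
  The last point is removed from the partition. If it was not a singleton block, then its block
  without it is an outer block, since an arc over that block would cross the arc to the last point;
  hence the last point can be inserted again after the maximum of that block.
\<close>

lemma noncrossing_realized:
  "\<pi> \<in> NC n \<Longrightarrow> \<exists>\<tau>\<in>perms_below n (long_cycle n). cycles n \<tau> = \<pi>"
proof (induction n arbitrary: \<pi>)
  case 0
  then have "\<pi> = {}" by (auto simp: NC_def partition_on_empty)
  moreover have "id \<in> perms_below 0 (long_cycle 0)"
    by (simp add: perms_below_def cycles_def permutes_id)
  ultimately show ?case by (auto simp: cycles_def)
next
  case (Suc n)
  then have part: "partition_on {..<Suc n} \<pi>" and nc: "noncrossing \<pi>" by (auto simp: NC_def)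
  obtain B where B: "B \<in> \<pi>" "n \<in> B" using part by (auto simp: partition_on_def)
  have other: "{..<n} \<inter> b = b" if "b \<in> \<pi>" "b \<noteq> B" for b
  proof -
    have "b \<subseteq> {..<Suc n}" "n \<notin> b"
      using that B part by (auto simp: partition_on_def dest: disjointD)
    then show ?thesis by (auto simp: less_Suc_eq)
  qed
  have BSuc: "B \<subseteq> {..<Suc n}" using B part by (auto simp: partition_on_def)
  then have B': "{..<n} \<inter> B = B - {n}" by auto
  define \<pi>' where "\<pi>' = (\<inter>) {..<n} ` \<pi> - {{}}"
  have "partition_on ({..<n} \<inter> {..<Suc n}) \<pi>'"
    unfolding \<pi>'_def by (rule partition_on_restrict[OF part])
  moreover have "{..<n} \<inter> {..<Suc n} = {..<n}" by auto
  moreover have "noncrossing \<pi>'"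
  proof -
    have "b = c"
      if bc: "b \<in> \<pi>'" "c \<in> \<pi>'" and x: "h < i" "i < j" "j < l" "h \<in> b" "j \<in> b" "i \<in> c" "l \<in> c"
      for b c h i j l
    proof -
      from bc obtain b' c' where b': "b' \<in> \<pi>" "c' \<in> \<pi>" "b = {..<n} \<inter> b'" "c = {..<n} \<inter> c'"
        unfolding \<pi>'_def by blast
      then have "b' = c'" using x by (intro noncrossingD[OF nc, of b' c' h i j l]) auto
      then show ?thesis using b' by simp
    qed
    then show ?thesis unfolding noncrossing_def by blast
  qed
  ultimately have "\<pi>' \<in> NC n" by (simp add: NC_def)
  then obtain \<tau> where \<tau>: "\<tau> \<in> perms_below n (long_cycle n)" and c\<tau>: "cycles n \<tau> = \<pi>'"
    using Suc.IH by blast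
  have \<tau>p: "\<tau> permutes {..<n}" using \<tau> by (rule perms_below_permutes)
  note p = permutes_permutation[OF \<tau>p]
  have "(\<inter>) {..<n} ` (\<pi> - {B}) = (\<lambda>b. b) ` (\<pi> - {B})"
    by (rule image_cong[OF refl]) (rule other, auto)
  then have "(\<inter>) {..<n} ` (\<pi> - {B}) = \<pi> - {B}" by simp
  moreover have "(\<inter>) {..<n} ` \<pi> = insert (B - {n}) ((\<inter>) {..<n} ` (\<pi> - {B}))"
    using B B' by (metis image_insert insert_Diff)
  moreover have "{} \<notin> \<pi>" using part by (auto simp: partition_on_def)
  ultimately have \<pi>': "\<pi>' = insert (B - {n}) (\<pi> - {B}) - {{}}" "{} \<notin> \<pi>" by (simp_all add: \<pi>'_def)
  show ?case
  proof (cases "B = {n}")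
    case True
    then have "insert {n} \<pi>' = \<pi>" using \<pi>' B by auto
    then have "cycles (Suc n) \<tau> = \<pi>" using cycles_Suc(1)[OF \<tau>p] c\<tau> by simp
    then show ?thesis using perms_below_fix_last[OF \<tau>] by blast
  next
    case False
    define B' where "B' = B - {n}"
    have ne: "B' \<noteq> {}" using False B by (auto simp: B'_def)
    then have B'\<pi>: "B' \<in> \<pi>'" by (auto simp: \<pi>' B'_def)
    have B'n: "B' \<subseteq> {..<n}" using BSuc by (auto simp: B'_def)
    then have n: "0 < n" using ne by auto
    define i where "i = Max B'"
    have fin: "finite B'" using B'n finite_subset by blast
    have i: "i \<in> B'" unfolding i_def using fin ne by simp
    then have iln: "i < n" using B'n by auto
    have orb: "B' = orbit \<tau> i" using cycle_eq_orbit[OF \<tau>p _ i] B'\<pi> c\<tau> by simp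
    then have \<tau>i: "\<tau> i \<le> i" unfolding i_def using fin by (metis Max_ge i_def orbit.base)
    have outer: "j \<notin> orbit \<tau> h" if "h < i" "i < j" "j < n" for h j
    proof
      assume j: "j \<in> orbit \<tau> h"
      have h: "h \<in> orbit \<tau> h" by (rule permutation_self_in_orbit[OF p])
      have o: "orbit \<tau> h \<in> \<pi>'" using that iln c\<tau> by (auto simp: cycles_def)
      have "orbit \<tau> h \<noteq> B'" using Max_ge[OF fin, of j] j that by (auto simp: i_def)
      then have "orbit \<tau> h \<in> \<pi>" "orbit \<tau> h \<noteq> B" using o by (auto simp: \<pi>' B'_def)
      moreover have "i \<in> B" using i by (simp add: B'_def)
      ultimately show False
        using noncrossingD[OF nc _ B(1), of "orbit \<tau> h" h i j n] B h j that by auto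
    qed
    have "i \<notin> orbit \<tau> n" using iln cycles_Suc(3)[OF \<tau>p] by simp
    then have "cycles (Suc n) (\<tau> \<circ> transpose n i) =
        insert ({n} \<union> B') (insert {n} \<pi>' - {{n}, B'})"
      using cycles_comp_transpose_merge[OF permutes_lessThan_Suc[OF \<tau>p], of n i] orb
      by (simp add: cycles_Suc[OF \<tau>p] c\<tau>)
    also have "{n} \<union> B' = B" using B by (auto simp: B'_def)
    also have "insert {n} \<pi>' - {{n}, B'} = \<pi> - {B}"
    proof -
      have "{n} \<notin> \<pi>" using B False part by (auto simp: partition_on_def dest: disjointD)
      moreover have "B' \<notin> \<pi>"
      proof
        assume "B' \<in> \<pi>"
        moreover have "B' \<noteq> B" using B by (auto simp: B'_def)
        moreover have "B' \<inter> B \<noteq> {}" using ne by (auto simp: B'_def)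
        ultimately show False using B part by (auto simp: partition_on_def dest: disjointD)
      qed
      ultimately show ?thesis using \<pi>' by (auto simp: B'_def)
    qed
    also have "insert B (\<pi> - {B}) = \<pi>" using B by auto
    finally have "cycles (Suc n) (\<tau> \<circ> transpose n i) = \<pi>" .
    moreover have "\<tau> \<circ> transpose n i \<in> perms_below (Suc n) (long_cycle (Suc n))"
    proof (rule perms_below_append_last[OF \<tau> n])
      show "i \<in> orbit (inv \<tau> \<circ> long_cycle n) (n - 1)"
        using \<tau> iln \<tau>i outer by (rule outer_maximum_reachable)
    qed
    ultimately show ?thesis by blast
  qed
qed

lemma bij_betw_cycles_NC: "bij_betw (cycles n) (perms_below n (long_cycle n)) (NC n)"
proof (rule bij_betw_imageI)
  show "cycles n ` perms_below n (long_cycle n) = NC n"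
    using noncrossing_cycles noncrossing_realized by blast
  show "inj_on (cycles n) (perms_below n (long_cycle n))"
  proof (rule inj_onI)
    fix \<sigma> \<tau> assume \<sigma>: "\<sigma> \<in> perms_below n (long_cycle n)" and \<tau>: "\<tau> \<in> perms_below n (long_cycle n)"
      and eq: "cycles n \<sigma> = cycles n \<tau>"
    note \<sigma>p = perms_below_permutes[OF \<sigma>] and \<tau>p = perms_below_permutes[OF \<tau>]
    show "\<sigma> = \<tau>"
    proof
      fix x show "\<sigma> x = \<tau> x"
      proof (cases "x < n")
        case True
        have "orbit \<sigma> x \<in> cycles n \<tau>" using True eq by (auto simp: cycles_def)
        then have o: "orbit \<sigma> x = orbit \<tau> x"
          using permutation_self_in_orbit[OF permutes_permutation[OF \<sigma>p]] by (rule cycle_eq_orbit[OF \<tau>p])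
        have "\<sigma> x \<in> orbit \<tau> x" "\<tau> x \<in> orbit \<sigma> x"
          using orbit.base[of \<sigma> x] orbit.base[of \<tau> x] unfolding o by simp_all
        then show ?thesis
          using increasing_cycles[OF \<sigma> True, of "\<tau> x"] increasing_cycles[OF \<tau> True, of "\<sigma> x"]
          by linarith
      next
        case False
        then show ?thesis using permutes_not_in[OF \<sigma>p] permutes_not_in[OF \<tau>p] by simp
      qed
    qed
  qed
qed

section \<open>Products over cycles\<close>

lemma funpow_orbit_bij:
  assumes "permutation \<sigma>"
  shows "bij_betw (\<lambda>t. (\<sigma> ^^ t) x) {..<card (orbit \<sigma> x)} (orbit \<sigma> x)"
    and "(\<sigma> ^^ card (orbit \<sigma> x)) x = x"
proof -
  have x: "x \<in> orbit \<sigma> x" by (rule permutation_self_in_orbit[OF assms])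
  have b: "bij_betw (\<lambda>t. (\<sigma> ^^ t) x) {0..<funpow_dist1 \<sigma> x x} (orbit \<sigma> x)"
    using inj_on_funpow_dist1[OF x] orbit_conv_funpow_dist1[OF x] unfolding bij_betw_def by simp
  then have c: "card (orbit \<sigma> x) = funpow_dist1 \<sigma> x x"
    using bij_betw_same_card[OF b] by simp
  show "bij_betw (\<lambda>t. (\<sigma> ^^ t) x) {..<card (orbit \<sigma> x)} (orbit \<sigma> x)"
    using b unfolding c lessThan_atLeast0 .
  show "(\<sigma> ^^ card (orbit \<sigma> x)) x = x" unfolding c by (rule funpow_dist1_prop[OF x])
qed

lemma length_along_cycle [simp]: "length (along_cycle \<sigma> x xs) = card (orbit \<sigma> x)"
  by (simp add: along_cycle_def)

lemma nths_eq_map_nth: "nths xs A = map ((!) xs) (nths [0..<length xs] A)"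
  by (metis map_nth nths_map)

text \<open>
  Started at its minimum, a cycle of a permutation below the long cycle is traversed in increasing
  order, which is the order of the entries in \<open>nths\<close>.
\<close>

lemma along_cycle_eq_nths:
  assumes \<tau>: "\<tau> \<in> perms_below n (long_cycle n)" and b: "b \<in> cycles n \<tau>" and n: "length xs = n"
  shows "along_cycle \<tau> (Min b) xs = nths xs b"
proof -
  have \<tau>p: "\<tau> permutes {..<n}" using \<tau> by (rule perms_below_permutes)
  note p = permutes_permutation[OF \<tau>p]
  have bn: "b \<subseteq> {..<n}" by (rule cycle_subset[OF \<tau>p b])
  then have fin: "finite b" by (rule finite_subset) simp
  have "b \<noteq> {}" using partition_on_cycles[OF \<tau>p] b by (auto simp: partition_on_def)
  define m where "m = Min b"
  have m: "m \<in> b" unfolding m_def using fin \<open>b \<noteq> {}\<close> by simp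
  have o: "orbit \<tau> m = b" using cycle_eq_orbit[OF \<tau>p b m] by simp
  define f where "f t = (\<tau> ^^ t) m" for t
  have bij: "bij_betw f {..<card b} b"
    using funpow_orbit_bij(1)[OF p, of m] unfolding o f_def .
  have step: "f t < f (Suc t)" if t: "Suc t < card b" for t
  proof (rule ccontr)
    assume le: "\<not> f t < f (Suc t)"
    have ft: "f t \<in> b" using bij t by (auto simp: bij_betw_def)
    then have "m \<in> orbit \<tau> (f t)" using cycle_eq_orbit[OF \<tau>p b ft] m by simp
    moreover have "f t < n" using ft bn by auto
    ultimately have "\<tau> (f t) \<le> m" using increasing_cycles(2)[OF \<tau>, of "f t" m] le by (simp add: f_def)
    moreover have "m \<le> f (Suc t)" unfolding m_def using bij_betwE[OF bij] t fin by simp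
    ultimately have "f (Suc t) = f 0" by (simp add: f_def)
    then show False using bij t by (auto simp: bij_betw_def dest: inj_onD)
  qed
  have "sorted_wrt (<) (map f [0..<card b])"
    by (subst sorted_wrt_iff_nth_Suc_transp) (auto simp: step)
  then have s: "sorted (map f [0..<card b])" "distinct (map f [0..<card b])"
    by (auto simp: strict_sorted_iff)
  have "set (map f [0..<card b]) = b" using bij by (simp add: bij_betw_def atLeast0LessThan)
  moreover have "set (nths [0..<n] b) = b"
    using bn by (auto simp: set_nths) (metis add_0 lessThan_iff nth_upt subsetD)
  moreover have "sorted (nths [0..<n] b)" "distinct (nths [0..<n] b)"
    by (auto intro: sorted_nths distinct_nthsI)
  ultimately have "map f [0..<card b] = nths [0..<n] b"
    using s by (intro sorted_distinct_set_unique) auto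
  then have "map ((!) xs) (map f [0..<card b]) = nths xs b"
    unfolding nths_eq_map_nth[of xs] n by simp
  then show ?thesis
    unfolding along_cycle_def m_def[symmetric] o by (simp add: f_def comp_def)
qed

lemma Min_cycle:
  assumes "\<sigma> permutes {..<k}" "c \<in> cycles k \<sigma>"
  shows "Min c \<in> c" "Min c < k"
proof -
  have c: "c \<subseteq> {..<k}" "c \<noteq> {}"
    using cycle_subset[OF assms] partition_on_cycles[OF assms(1)] assms(2)
    by (auto simp: partition_on_def)
  show "Min c \<in> c" using c by (intro Min_in) (auto intro: finite_subset)
  then show "Min c < k" using c by auto
qed

text \<open>
  The start at the minimum is an arbitrary choice; for functions that are invariant under rotation
  of lists any other choice gives the same product (\<open>cycle_prod_start\<close>).
\<close>

definition cycle_prod :: "('a list \<Rightarrow> complex) \<Rightarrow> (nat \<Rightarrow> nat) \<Rightarrow> 'a list \<Rightarrow> complex" where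
  "cycle_prod f \<sigma> xs = (\<Prod>c\<in>cycles (length xs) \<sigma>. f (along_cycle \<sigma> (Min c) xs))"

lemma long_cycle_moment:
  assumes "is_free_cumulants m f" "length xs = n"
  shows "m (perm_diagram n (long_cycle n)) xs =
    (\<Sum>\<tau>\<in>perms_below n (long_cycle n). cycle_prod f \<tau> xs)"
proof -
  have "m (perm_diagram n (long_cycle n)) xs = (\<Sum>\<pi>\<in>NC n. \<Prod>b\<in>\<pi>. f (nths xs b))"
    using assms unfolding is_free_cumulants_def long_cycle_def by blast
  also have "\<dots> = (\<Sum>\<tau>\<in>perms_below n (long_cycle n). \<Prod>b\<in>cycles n \<tau>. f (nths xs b))"
    by (rule sum.reindex_bij_betw[OF bij_betw_cycles_NC, symmetric])
  also have "\<dots> = (\<Sum>\<tau>\<in>perms_below n (long_cycle n). cycle_prod f \<tau> xs)"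
    using assms(2) by (intro sum.cong refl) (simp add: cycle_prod_def along_cycle_eq_nths)
  finally show ?thesis .
qed

lemma along_cycle_rotate:
  assumes "permutation \<sigma>" "y \<in> orbit \<sigma> x"
  obtains t where "along_cycle \<sigma> y xs = rotate t (along_cycle \<sigma> x xs)"
proof -
  let ?n = "card (orbit \<sigma> x)"
  obtain t where t: "y = (\<sigma> ^^ t) x" using assms(2) by (auto simp: orbit_altdef)
  have o: "orbit \<sigma> y = orbit \<sigma> x" by (rule orbit_eq[OF assms])
  have "along_cycle \<sigma> y xs = rotate t (along_cycle \<sigma> x xs)"
  proof (rule nth_equalityI)
    fix i assume "i < length (along_cycle \<sigma> y xs)"
    then have i: "i < ?n" by (simp add: o)
    then have "(t + i) mod ?n < ?n" by simp
    moreover have "(\<sigma> ^^ ((t + i) mod ?n)) x = (\<sigma> ^^ i) y"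
      unfolding t using funpow_mod_eq[OF funpow_orbit_bij(2)[OF assms(1)], of "t + i" x]
      by (simp add: add.commute[of t i] funpow_add)
    ultimately show "along_cycle \<sigma> y xs ! i = rotate t (along_cycle \<sigma> x xs) ! i"
      using i by (subst nth_rotate) (simp_all add: along_cycle_def o)
  qed (simp add: o)
  then show ?thesis by (rule that)
qed

lemma along_cycle_start:
  assumes "permutation \<sigma>" "y \<in> orbit \<sigma> x"
    and "\<And>ys. length ys = card (orbit \<sigma> x) \<Longrightarrow> f (rotate1 ys) = f ys"
  shows "f (along_cycle \<sigma> y xs) = f (along_cycle \<sigma> x xs)"
proof -
  have r: "f (rotate t ys) = f ys" if "length ys = card (orbit \<sigma> x)" for t ys
    using that by (induction t) (auto simp: assms(3))
  obtain t where "along_cycle \<sigma> y xs = rotate t (along_cycle \<sigma> x xs)"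
    by (rule along_cycle_rotate[OF assms(1,2)])
  then show ?thesis by (simp add: r)
qed

abbreviation conjugate :: "(nat \<Rightarrow> nat) \<Rightarrow> (nat \<Rightarrow> nat) \<Rightarrow> nat \<Rightarrow> nat" where
  "conjugate \<rho> \<sigma> \<equiv> \<rho> \<circ> \<sigma> \<circ> inv \<rho>"

lemma conjugate_permutes:
  "\<rho> permutes S \<Longrightarrow> \<sigma> permutes S \<Longrightarrow> conjugate \<rho> \<sigma> permutes S"
  by (intro permutes_compose permutes_inv)

lemma conjugate_apply: "\<rho> permutes S \<Longrightarrow> conjugate \<rho> \<sigma> (\<rho> x) = \<rho> (\<sigma> x)"
  by (simp add: permutes_inverses)

lemma orbit_conjugate:
  assumes "\<rho> permutes S" "permutation \<sigma>"
  shows "orbit (conjugate \<rho> \<sigma>) (\<rho> x) = \<rho> ` orbit \<sigma> x"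
proof -
  have "\<rho> ` orbit \<sigma> x = orbit (conjugate \<rho> \<sigma>) (\<rho> x)"
    by (rule orbit_inverse[OF permutation_self_in_orbit[OF assms(2)]]) (rule conjugate_apply[OF assms(1)])
  then show ?thesis ..
qed

lemma cycles_conjugate:
  assumes \<rho>: "\<rho> permutes {..<k}" and \<sigma>: "\<sigma> permutes {..<k}"
  shows "cycles k (conjugate \<rho> \<sigma>) = (`) \<rho> ` cycles k \<sigma>"
    and "card (cycles k (conjugate \<rho> \<sigma>)) = card (cycles k \<sigma>)"
proof -
  have "cycles k (conjugate \<rho> \<sigma>) = orbit (conjugate \<rho> \<sigma>) ` \<rho> ` {..<k}"
    by (simp add: cycles_def permutes_image[OF \<rho>])
  also have "\<dots> = (`) \<rho> ` cycles k \<sigma>"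
    unfolding image_image cycles_def orbit_conjugate[OF \<rho> permutes_permutation[OF \<sigma>]] ..
  finally show c: "cycles k (conjugate \<rho> \<sigma>) = (`) \<rho> ` cycles k \<sigma>" .
  show "card (cycles k (conjugate \<rho> \<sigma>)) = card (cycles k \<sigma>)"
    unfolding c by (rule card_image) (use permutes_inj[OF \<rho>] in \<open>auto simp: inj_on_def inj_image_eq_iff\<close>)
qed

lemma along_cycle_conjugate:
  assumes \<rho>: "\<rho> permutes {..<length xs}" and \<sigma>: "\<sigma> permutes {..<length xs}" and x: "x < length xs"
  shows "along_cycle (conjugate \<rho> \<sigma>) (\<rho> x) (permute_list (inv \<rho>) xs) = along_cycle \<sigma> x xs"
proof -
  have "card (orbit (conjugate \<rho> \<sigma>) (\<rho> x)) = card (orbit \<sigma> x)"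
    unfolding orbit_conjugate[OF \<rho> permutes_permutation[OF \<sigma>]]
    by (rule card_image) (use permutes_inj[OF \<rho>] in \<open>auto intro: inj_on_subset\<close>)
  moreover have "(conjugate \<rho> \<sigma> ^^ t) (\<rho> x) = \<rho> ((\<sigma> ^^ t) x)" for t
    by (induction t) (simp_all add: permutes_inverses[OF \<rho>])
  moreover have "permute_list (inv \<rho>) xs ! \<rho> ((\<sigma> ^^ t) x) = xs ! ((\<sigma> ^^ t) x)" for t
  proof -
    have "(\<sigma> ^^ t) x < length xs"
      using permutes_in_image[OF permutes_funpow[OF \<sigma>, of t], of x] x by simp
    moreover from this have "\<rho> ((\<sigma> ^^ t) x) < length xs"
      using permutes_in_image[OF \<rho>, of "(\<sigma> ^^ t) x"] by simp
    ultimately show ?thesis by (simp add: permute_list_def permutes_inverses[OF \<rho>])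
  qed
  ultimately show ?thesis by (simp add: along_cycle_def)
qed

lemma cycle_prod_start:
  assumes \<sigma>: "\<sigma> permutes {..<length xs}"
    and start: "\<And>c. c \<in> cycles (length xs) \<sigma> \<Longrightarrow> start c \<in> c"
    and f: "\<And>c ys. c \<in> cycles (length xs) \<sigma> \<Longrightarrow> length ys = card c \<Longrightarrow> f (rotate1 ys) = f ys"
  shows "cycle_prod f \<sigma> xs = (\<Prod>c\<in>cycles (length xs) \<sigma>. f (along_cycle \<sigma> (start c) xs))"
  unfolding cycle_prod_def
proof (rule prod.cong[OF refl])
  fix c assume c: "c \<in> cycles (length xs) \<sigma>"
  have o: "orbit \<sigma> (start c) = c" using cycle_eq_orbit[OF \<sigma> c start[OF c]] by simp
  have "finite c" by (rule finite_subset[OF cycle_subset[OF \<sigma> c]]) simp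
  then have "Min c \<in> orbit \<sigma> (start c)" unfolding o using start[OF c] by (intro Min_in) auto
  then show "f (along_cycle \<sigma> (Min c) xs) = f (along_cycle \<sigma> (start c) xs)"
    using f[OF c] by (intro along_cycle_start permutes_permutation[OF \<sigma>]) (simp_all add: o)
qed

text \<open>
  Rotation invariance is required only for the lengths that occur as cycle lengths of \<open>\<sigma>\<close>: the
  inductive proof that free cumulants are rotation invariant has no more at its disposal.
\<close>

lemma cycle_prod_conjugate:
  assumes \<rho>: "\<rho> permutes {..<length xs}" and \<sigma>: "\<sigma> permutes {..<length xs}"
    and f: "\<And>c ys. c \<in> cycles (length xs) \<sigma> \<Longrightarrow> length ys = card c \<Longrightarrow> f (rotate1 ys) = f ys"
  shows "cycle_prod f (conjugate \<rho> \<sigma>) (permute_list (inv \<rho>) xs) = cycle_prod f \<sigma> xs"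
proof -
  let ?k = "length xs"
  have inj: "inj_on ((`) \<rho>) (cycles ?k \<sigma>)"
    using permutes_inj[OF \<rho>] by (auto simp: inj_on_def inj_image_eq_iff)
  have inverse_image: "inv \<rho> ` \<rho> ` c = c" for c by (simp add: image_image permutes_inverses[OF \<rho>])
  have min: "Min c \<in> c \<and> Min c < ?k" if "c \<in> cycles ?k \<sigma>" for c
    using Min_cycle[OF \<sigma> that] by blast
  have "cycle_prod f (conjugate \<rho> \<sigma>) (permute_list (inv \<rho>) xs) =
      (\<Prod>c\<in>cycles ?k (conjugate \<rho> \<sigma>).
        f (along_cycle (conjugate \<rho> \<sigma>) (\<rho> (Min (inv \<rho> ` c))) (permute_list (inv \<rho>) xs)))"
  proof (subst cycle_prod_start[where start = "\<lambda>c. \<rho> (Min (inv \<rho> ` c))"])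
    show "conjugate \<rho> \<sigma> permutes {..<length (permute_list (inv \<rho>) xs)}"
      using conjugate_permutes[OF \<rho> \<sigma>] by simp
    fix c assume "c \<in> cycles (length (permute_list (inv \<rho>) xs)) (conjugate \<rho> \<sigma>)"
    then obtain d where d: "d \<in> cycles ?k \<sigma>" "c = \<rho> ` d" by (auto simp: cycles_conjugate[OF \<rho> \<sigma>])
    show "\<rho> (Min (inv \<rho> ` c)) \<in> c" unfolding d inverse_image using min[OF d(1)] by simp
    have "card c = card d"
      unfolding d by (rule card_image) (use permutes_inj[OF \<rho>] in \<open>auto intro: inj_on_subset\<close>)
    then show "f (rotate1 ys) = f ys" if "length ys = card c" for ys using f[OF d(1)] that by simp
  qed simp
  also have "\<dots> = (\<Prod>c\<in>cycles ?k \<sigma>. f (along_cycle (conjugate \<rho> \<sigma>) (\<rho> (Min c)) (permute_list (inv \<rho>) xs)))"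
    unfolding cycles_conjugate(1)[OF \<rho> \<sigma>] prod.reindex[OF inj] by (simp add: inverse_image)
  also have "\<dots> = cycle_prod f \<sigma> xs"
    unfolding cycle_prod_def
    by (intro prod.cong refl arg_cong[of _ _ f] along_cycle_conjugate[OF \<rho> \<sigma>]) (use min in auto)
  finally show ?thesis .
qed

lemma conjugate_inverse:
  assumes "\<rho> permutes S"
  shows "conjugate (inv \<rho>) (conjugate \<rho> \<sigma>) = \<sigma>" "conjugate \<rho> (conjugate (inv \<rho>) \<sigma>) = \<sigma>"
  using permutes_inv_inv[OF assms] by (simp_all add: fun_eq_iff permutes_inverses[OF assms])

section \<open>Cyclic invariance of free cumulants\<close>

lemma perms_below_conjugate:
  assumes \<rho>: "\<rho> permutes {..<k}" and \<sigma>: "\<sigma> permutes {..<k}" and \<tau>: "\<tau> \<in> perms_below k \<sigma>"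
  shows "conjugate \<rho> \<tau> \<in> perms_below k (conjugate \<rho> \<sigma>)"
proof -
  have \<tau>p: "\<tau> permutes {..<k}" using \<tau> by (rule perms_below_permutes)
  have "inv (conjugate \<rho> \<tau>) \<circ> conjugate \<rho> \<sigma> = conjugate \<rho> (inv \<tau> \<circ> \<sigma>)"
  proof -
    have "inv (conjugate \<rho> \<tau>) = conjugate \<rho> (inv \<tau>)"
      using permutes_bij[OF \<rho>] permutes_bij[OF \<tau>p] permutes_bij[OF permutes_inv[OF \<rho>]]
      by (simp add: o_inv_distrib bij_comp comp_assoc permutes_inv_inv[OF \<rho>])
    then show ?thesis by (simp add: fun_eq_iff permutes_inverses[OF \<rho>])
  qed
  moreover have "inv \<tau> \<circ> \<sigma> permutes {..<k}" by (rule permutes_compose[OF \<sigma> permutes_inv[OF \<tau>p]])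
  ultimately show ?thesis
    using \<tau> cycles_conjugate(2)[OF \<rho>] \<tau>p \<sigma> conjugate_permutes[OF \<rho> \<tau>p]
    by (simp add: perms_below_def)
qed

lemma perms_below_conjugate_bij:
  assumes \<rho>: "\<rho> permutes {..<k}" and \<sigma>: "\<sigma> permutes {..<k}"
  shows "bij_betw (conjugate \<rho>) (perms_below k \<sigma>) (perms_below k (conjugate \<rho> \<sigma>))"
proof (rule bij_betw_byWitness[where f' = "conjugate (inv \<rho>)"])
  show "conjugate (inv \<rho>) ` perms_below k (conjugate \<rho> \<sigma>) \<subseteq> perms_below k \<sigma>"
    using perms_below_conjugate[OF permutes_inv[OF \<rho>] conjugate_permutes[OF \<rho> \<sigma>]]
    by (auto simp only: conjugate_inverse[OF \<rho>])
qed (use perms_below_conjugate[OF \<rho> \<sigma>] conjugate_inverse[OF \<rho>] in \<open>auto simp only:\<close>)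

lemma funpow_long_cycle: "t < n \<Longrightarrow> (long_cycle n ^^ t) 0 = t"
  by (induction t) (auto simp: long_cycle_apply)

lemma cycle_prod_long_cycle:
  assumes "xs \<noteq> []"
  shows "cycle_prod f (long_cycle (length xs)) xs = f xs"
proof -
  let ?n = "length xs"
  have n: "0 < ?n" using assms by simp
  have "along_cycle (long_cycle ?n) 0 xs = map ((!) xs) [0..<?n]"
    using n by (auto simp: along_cycle_def orbit_long_cycle funpow_long_cycle)
  moreover have "Min {..<?n} = 0" using n by (intro Min_eqI) auto
  ultimately show ?thesis using n by (simp add: cycle_prod_def cycles_long_cycle map_nth)
qed

lemma full_cycle_below:
  assumes \<tau>: "\<tau> \<in> perms_below n (long_cycle n)" and c: "c \<in> cycles n \<tau>" "card c = n"
  shows "\<tau> = long_cycle n"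
proof -
  have \<tau>p: "\<tau> permutes {..<n}" using \<tau> by (rule perms_below_permutes)
  have "c = {..<n}" using cycle_subset[OF \<tau>p c(1)] c(2) by (intro card_subset_eq) auto
  then have "orbit \<tau> x = {..<n}" if "x < n" for x
    using cycle_eq_orbit[OF \<tau>p c(1), of x] that by simp
  then have "cycles n \<tau> = cycles n (long_cycle n)"
    unfolding cycles_def by (intro image_cong refl) (simp add: orbit_long_cycle)
  moreover have "inj_on (cycles n) (perms_below n (long_cycle n))"
    using bij_betw_cycles_NC by (rule bij_betw_imp_inj_on)
  ultimately show ?thesis
    using \<tau> self_below[OF long_cycle_permutes] by (auto dest: inj_onD)
qed

text \<open>
  In \<open>permute_list (inv \<rho>) xs\<close> the entry at position \<open>i\<close> of \<open>xs\<close> is found at position \<open>\<rho> i\<close>.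
\<close>

definition conjugation_invariant :: "(diagram \<Rightarrow> 'a list \<Rightarrow> complex) \<Rightarrow> bool" where
  "conjugation_invariant m \<longleftrightarrow> (\<forall>\<sigma> \<rho> xs. \<sigma> permutes {..<length xs} \<longrightarrow> \<rho> permutes {..<length xs} \<longrightarrow>
     m (perm_diagram (length xs) (conjugate \<rho> \<sigma>)) (permute_list (inv \<rho>) xs) =
     m (perm_diagram (length xs) \<sigma>) xs)"

text \<open>
  The long cycle \<open>\<gamma>\<close> commutes with itself, so its moment is invariant under conjugation by \<open>\<gamma>\<^sup>-\<^sup>1\<close>,
  which rotates the list. The same conjugation permutes the \<open>\<tau>\<close> below \<open>\<gamma>\<close> other than \<open>\<gamma>\<close> itself; these
  have shorter cycles only, so that by induction their contributions to the moment agree. The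
  remaining contribution, from \<open>\<gamma>\<close>, is the free cumulant of the whole list.
\<close>

lemma free_cumulants_rotate1:
  assumes m: "conjugation_invariant m" and f: "is_free_cumulants m f"
  shows "f (rotate1 xs) = f xs"
proof (induction xs rule: measure_induct_rule[of length])
  case (less xs)
  show ?case
  proof (cases "xs = []")
    case False
    define n where "n = length xs"
    define \<gamma> where "\<gamma> = long_cycle n"
    have n: "0 < n" using False by (simp add: n_def)
    have \<gamma>: "\<gamma> permutes {..<n}" unfolding \<gamma>_def by (rule long_cycle_permutes)
    note \<rho> = permutes_inv[OF \<gamma>]
    have conj: "conjugate (inv \<gamma>) \<gamma> = \<gamma>"
      using permutes_inv_inv[OF \<gamma>] by (simp add: fun_eq_iff permutes_inverses[OF \<gamma>])
    define ys where "ys = permute_list (inv (inv \<gamma>)) xs"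
    have ys: "ys = rotate1 xs"
    proof (rule nth_equalityI)
      fix i assume "i < length ys"
      then have i: "i < n" by (simp add: ys_def n_def)
      then have "\<gamma> i = Suc i mod n"
        unfolding \<gamma>_def long_cycle_apply by (cases "Suc i = n") auto
      then show "ys ! i = rotate1 xs ! i"
        using i by (simp add: ys_def permute_list_def permutes_inv_inv[OF \<gamma>] nth_rotate1 flip: n_def)
    qed (simp add: ys_def)
    have len: "length ys = n" by (simp add: ys_def n_def)
    have split: "m (perm_diagram n \<gamma>) zs = f zs + (\<Sum>\<tau>\<in>perms_below n \<gamma> - {\<gamma>}. cycle_prod f \<tau> zs)"
      if "length zs = n" for zs
    proof -
      have "zs \<noteq> []" using that n by auto
      from cycle_prod_long_cycle[OF this, of f] show ?thesis
        using that self_below[OF \<gamma>] long_cycle_moment[OF f that]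
        by (simp add: sum.remove[of _ \<gamma>] flip: \<gamma>_def)
    qed
    have "(\<Sum>\<tau>\<in>perms_below n \<gamma> - {\<gamma>}. cycle_prod f \<tau> xs) =
        (\<Sum>\<tau>\<in>perms_below n \<gamma> - {\<gamma>}. cycle_prod f (conjugate (inv \<gamma>) \<tau>) ys)"
    proof (rule sum.cong[OF refl])
      fix \<tau> assume \<tau>: "\<tau> \<in> perms_below n \<gamma> - {\<gamma>}"
      then have \<tau>p: "\<tau> permutes {..<n}" using perms_below_permutes by blast
      have "f (rotate1 zs) = f zs" if c: "c \<in> cycles n \<tau>" and zs: "length zs = card c" for c zs
      proof (rule less.IH)
        have "card c \<le> card {..<n}" using cycle_subset[OF \<tau>p c] by (intro card_mono) auto
        moreover have "card c \<noteq> n" using full_cycle_below[of \<tau> n c] \<tau> c by (auto simp: \<gamma>_def)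
        ultimately show "length zs < length xs" using zs by (simp flip: n_def)
      qed
      then show "cycle_prod f \<tau> xs = cycle_prod f (conjugate (inv \<gamma>) \<tau>) ys"
        unfolding ys_def using \<rho> \<tau>p by (intro cycle_prod_conjugate[symmetric]) (auto simp flip: n_def)
    qed
    also have "\<dots> = (\<Sum>\<tau>\<in>perms_below n \<gamma> - {\<gamma>}. cycle_prod f \<tau> ys)"
    proof (rule sum.reindex_bij_betw)
      have "bij_betw (conjugate (inv \<gamma>)) (perms_below n \<gamma>) (perms_below n \<gamma>)"
        using perms_below_conjugate_bij[OF \<rho> \<gamma>] unfolding conj .
      then show "bij_betw (conjugate (inv \<gamma>)) (perms_below n \<gamma> - {\<gamma>}) (perms_below n \<gamma> - {\<gamma>})"
        using self_below[OF \<gamma>] conj by (intro bij_betw_DiffI) (auto simp: bij_betw_def)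
    qed
    finally have "(\<Sum>\<tau>\<in>perms_below n \<gamma> - {\<gamma>}. cycle_prod f \<tau> xs) =
        (\<Sum>\<tau>\<in>perms_below n \<gamma> - {\<gamma>}. cycle_prod f \<tau> ys)" .
    moreover have "m (perm_diagram n \<gamma>) ys = m (perm_diagram n \<gamma>) xs"
      using m \<rho> \<gamma> unfolding conjugation_invariant_def ys_def n_def by (metis conj n_def)
    ultimately show ?thesis using split[of xs] split[of ys] len by (simp add: ys n_def)
  qed simp
qed

section \<open>Direct sums of permutations\<close>

definition direct_sum :: "nat \<Rightarrow> (nat \<Rightarrow> nat) \<Rightarrow> (nat \<Rightarrow> nat) \<Rightarrow> nat \<Rightarrow> nat" where
  "direct_sum n \<sigma> \<tau> i = (if i < n then \<sigma> i else n + \<tau> (i - n))"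

lemma lessThan_add: "{..<n + l} = {..<n} \<union> (+) n ` {..<l :: nat}"
proof (intro equalityI subsetI)
  fix i assume "i \<in> {..<n + l}"
  then show "i \<in> {..<n} \<union> (+) n ` {..<l}"
    by (cases "i < n") (auto intro!: image_eqI[of _ _ "i - n"])
qed auto

lemma direct_sum_comp:
  assumes "\<sigma>' permutes {..<n}"
  shows "direct_sum n \<sigma> \<tau> \<circ> direct_sum n \<sigma>' \<tau>' = direct_sum n (\<sigma> \<circ> \<sigma>') (\<tau> \<circ> \<tau>')"
  using permutes_in_image[OF assms] by (auto simp: fun_eq_iff direct_sum_def)

lemma direct_sum_inverse:
  assumes "\<sigma> permutes {..<n}" "\<tau> permutes {..<l}"
  shows "direct_sum n \<sigma> \<tau> permutes {..<n + l}"
    and "inv (direct_sum n \<sigma> \<tau>) = direct_sum n (inv \<sigma>) (inv \<tau>)"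
proof -
  have "direct_sum n \<sigma> \<tau> \<circ> direct_sum n (inv \<sigma>) (inv \<tau>) = id"
    "direct_sum n (inv \<sigma>) (inv \<tau>) \<circ> direct_sum n \<sigma> \<tau> = id"
    unfolding direct_sum_comp[OF assms(1)] direct_sum_comp[OF permutes_inv[OF assms(1)]]
      permutes_inv_o[OF assms(1)] permutes_inv_o[OF assms(2)]
    by (auto simp: direct_sum_def fun_eq_iff)
  then have "bij (direct_sum n \<sigma> \<tau>)" and i: "inv (direct_sum n \<sigma> \<tau>) = direct_sum n (inv \<sigma>) (inv \<tau>)"
    by (auto intro: o_bij inv_unique_comp)
  moreover have "direct_sum n \<sigma> \<tau> i = i" if "i \<notin> {..<n + l}" for i
    using that permutes_not_in[OF assms(2), of "i - n"] by (auto simp: direct_sum_def)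
  ultimately show "direct_sum n \<sigma> \<tau> permutes {..<n + l}"
    by (simp add: permutes_def bij_iff)
  show "inv (direct_sum n \<sigma> \<tau>) = direct_sum n (inv \<sigma>) (inv \<tau>)" by (rule i)
qed

lemma orbit_direct_sum:
  assumes \<sigma>: "\<sigma> permutes {..<n}" and \<tau>: "\<tau> permutes {..<l}"
  shows "x < n \<Longrightarrow> orbit (direct_sum n \<sigma> \<tau>) x = orbit \<sigma> x"
    and "orbit (direct_sum n \<sigma> \<tau>) (n + x) = (+) n ` orbit \<tau> x"
proof -
  show "orbit (direct_sum n \<sigma> \<tau>) x = orbit \<sigma> x" if "x < n"
    using permutes_orbit_subset[OF \<sigma>, of x] that
    by (intro orbit_cong permutation_self_in_orbit permutes_permutation[OF \<sigma>]) (auto simp: direct_sum_def)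
  have "(+) n ` orbit \<tau> x = orbit (direct_sum n \<sigma> \<tau>) (n + x)"
    by (rule orbit_inverse[OF permutation_self_in_orbit[OF permutes_permutation[OF \<tau>]]])
       (simp add: direct_sum_def)
  then show "orbit (direct_sum n \<sigma> \<tau>) (n + x) = (+) n ` orbit \<tau> x" ..
qed

lemma cycles_direct_sum:
  assumes \<sigma>: "\<sigma> permutes {..<n}" and \<tau>: "\<tau> permutes {..<l}"
  shows "cycles (n + l) (direct_sum n \<sigma> \<tau>) = cycles n \<sigma> \<union> (`) ((+) n) ` cycles l \<tau>"
    and "cycles n \<sigma> \<inter> (`) ((+) n) ` cycles l \<tau> = {}"
    and "card (cycles (n + l) (direct_sum n \<sigma> \<tau>)) = card (cycles n \<sigma>) + card (cycles l \<tau>)"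
proof -
  show c: "cycles (n + l) (direct_sum n \<sigma> \<tau>) = cycles n \<sigma> \<union> (`) ((+) n) ` cycles l \<tau>"
    unfolding cycles_def lessThan_add by (simp add: image_Un image_image orbit_direct_sum[OF \<sigma> \<tau>])
  have False if "c \<in> cycles n \<sigma>" "c = (+) n ` d" "d \<in> cycles l \<tau>" for c d
  proof -
    have "d \<noteq> {}" using that(3) partition_on_cycles[OF \<tau>] by (auto simp: partition_on_def)
    then show False using that cycle_subset[OF \<sigma>, of c] by auto
  qed
  then show d: "cycles n \<sigma> \<inter> (`) ((+) n) ` cycles l \<tau> = {}" by blast
  have "inj_on ((`) ((+) n)) (cycles l \<tau>)"
    by (auto simp: inj_on_def inj_image_eq_iff)
  then show "card (cycles (n + l) (direct_sum n \<sigma> \<tau>)) = card (cycles n \<sigma>) + card (cycles l \<tau>)"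
    unfolding c by (subst card_Un_disjoint) (simp_all add: d card_image)
qed

lemma cycle_prod_direct_sum:
  assumes \<sigma>: "\<sigma> permutes {..<length xs}" and \<tau>: "\<tau> permutes {..<length ys}"
  shows "cycle_prod f (direct_sum (length xs) \<sigma> \<tau>) (xs @ ys) = cycle_prod f \<sigma> xs * cycle_prod f \<tau> ys"
proof -
  let ?n = "length xs" and ?l = "length ys" and ?s = "direct_sum (length xs) \<sigma> \<tau>"
  have left: "along_cycle ?s (Min c) (xs @ ys) = along_cycle \<sigma> (Min c) xs" if c: "c \<in> cycles ?n \<sigma>" for c
  proof -
    have x: "Min c < ?n" by (rule Min_cycle(2)[OF \<sigma> c])
    have lt: "(\<sigma> ^^ t) (Min c) < ?n" for t
      using permutes_in_image[OF permutes_funpow[OF \<sigma>, of t], of "Min c"] x by simp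
    have "(?s ^^ t) (Min c) = (\<sigma> ^^ t) (Min c)" for t
      by (induction t) (use lt in \<open>auto simp: direct_sum_def\<close>)
    then show ?thesis using lt by (simp add: along_cycle_def orbit_direct_sum(1)[OF \<sigma> \<tau> x] nth_append)
  qed
  have right: "along_cycle ?s (Min ((+) ?n ` c)) (xs @ ys) = along_cycle \<tau> (Min c) ys"
    if c: "c \<in> cycles ?l \<tau>" for c
  proof -
    have "c \<subseteq> {..<?l}" "c \<noteq> {}"
      using cycle_subset[OF \<tau> c] partition_on_cycles[OF \<tau>] c by (auto simp: partition_on_def)
    then have m: "Min ((+) ?n ` c) = ?n + Min c"
      by (intro mono_Min_commute[symmetric] monoI) (auto intro: finite_subset)
    have "(?s ^^ t) (?n + Min c) = ?n + (\<tau> ^^ t) (Min c)" for t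
      by (induction t) (auto simp: direct_sum_def)
    then show ?thesis
      unfolding m by (simp add: along_cycle_def orbit_direct_sum(2)[OF \<sigma> \<tau>] card_image nth_append)
  qed
  have inj: "inj_on ((`) ((+) ?n)) (cycles ?l \<tau>)"
    by (auto simp: inj_on_def inj_image_eq_iff)
  show ?thesis
    unfolding cycle_prod_def length_append cycles_direct_sum(1)[OF \<sigma> \<tau>]
    by (subst prod.union_disjoint) (simp_all add: cycles_direct_sum(2)[OF \<sigma> \<tau>] prod.reindex[OF inj] left right)
qed

lemma direct_sum_decomposition:
  assumes \<alpha>: "\<alpha> permutes {..<n + l}" and inv: "\<And>i. i < n \<Longrightarrow> \<alpha> i < n"
  obtains \<sigma> \<tau> where "\<sigma> permutes {..<n}" "\<tau> permutes {..<l}" "\<alpha> = direct_sum n \<sigma> \<tau>"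
proof -
  define \<sigma> where "\<sigma> i = (if i < n then \<alpha> i else i)" for i
  define \<tau> where "\<tau> i = \<alpha> (n + i) - n" for i
  have inj: "inj \<alpha>" by (rule permutes_inj[OF \<alpha>])
  have "\<alpha> ` {..<n} = {..<n}"
    using inv inj by (intro card_subset_eq) (auto simp: card_image inj_on_def inj_def)
  then have ge: "n \<le> \<alpha> i" if "n \<le> i" for i
    using that inj by (metis image_iff inj_eq lessThan_iff linorder_not_less)
  have "\<alpha> = direct_sum n \<sigma> \<tau>"
    using ge by (auto simp: fun_eq_iff direct_sum_def \<sigma>_def \<tau>_def)
  moreover have "\<sigma> permutes {..<n}"
  proof (rule bij_imp_permutes)
    show "bij_betw \<sigma> {..<n} {..<n}"
      using \<open>\<alpha> ` {..<n} = {..<n}\<close> inj by (auto simp: bij_betw_def \<sigma>_def inj_on_def inj_def)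
  qed (simp add: \<sigma>_def)
  moreover have "\<tau> permutes {..<l}"
  proof (rule bij_imp_permutes)
    have "inj_on \<tau> {..<l}"
    proof (rule inj_onI)
      fix i j assume "\<tau> i = \<tau> j"
      then have "\<alpha> (n + i) = \<alpha> (n + j)"
        unfolding \<tau>_def using ge[of "n + i"] ge[of "n + j"] by simp
      then show "i = j" using inj by (simp add: inj_eq)
    qed
    moreover have "\<tau> ` {..<l} \<subseteq> {..<l}"
    proof
      fix j assume "j \<in> \<tau> ` {..<l}"
      then obtain i where i: "i < l" "j = \<alpha> (n + i) - n" by (auto simp: \<tau>_def)
      then have "\<alpha> (n + i) < n + l" using permutes_in_image[OF \<alpha>, of "n + i"] by simp
      then show "j \<in> {..<l}" using i ge[of "n + i"] by simp
    qed
    ultimately show "bij_betw \<tau> {..<l} {..<l}"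
      unfolding bij_betw_def by (simp add: card_image card_subset_eq)
    show "\<tau> i = i" if "i \<notin> {..<l}" for i
      using permutes_not_in[OF \<alpha>, of "n + i"] that by (simp add: \<tau>_def)
  qed
  ultimately show ?thesis using that by blast
qed

text \<open>
  A permutation below \<open>\<sigma> \<oplus> \<tau>\<close> has cycles inside those of \<open>\<sigma> \<oplus> \<tau>\<close>, so it is itself a direct sum. Cycle
  counts are additive, hence equality for the sum is equality in both triangle inequalities.
\<close>

lemma perms_below_direct_sum:
  assumes \<sigma>: "\<sigma> permutes {..<n}" and \<tau>: "\<tau> permutes {..<l}"
  shows "bij_betw (\<lambda>(\<sigma>', \<tau>'). direct_sum n \<sigma>' \<tau>') (perms_below n \<sigma> \<times> perms_below l \<tau>)
    (perms_below (n + l) (direct_sum n \<sigma> \<tau>))"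
proof -
  let ?s = "direct_sum n \<sigma> \<tau>"
  have below: "direct_sum n \<sigma>' \<tau>' \<in> perms_below (n + l) ?s \<longleftrightarrow>
      \<sigma>' \<in> perms_below n \<sigma> \<and> \<tau>' \<in> perms_below l \<tau>"
    if \<sigma>': "\<sigma>' permutes {..<n}" and \<tau>': "\<tau>' permutes {..<l}" for \<sigma>' \<tau>'
  proof -
    have i: "inv \<sigma>' \<circ> \<sigma> permutes {..<n}" "inv \<tau>' \<circ> \<tau> permutes {..<l}"
      by (rule permutes_compose[OF \<sigma> permutes_inv[OF \<sigma>']], rule permutes_compose[OF \<tau> permutes_inv[OF \<tau>']])
    have "inv (direct_sum n \<sigma>' \<tau>') \<circ> ?s = direct_sum n (inv \<sigma>' \<circ> \<sigma>) (inv \<tau>' \<circ> \<tau>)"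
      unfolding direct_sum_inverse(2)[OF \<sigma>' \<tau>'] by (rule direct_sum_comp[OF \<sigma>])
    then show ?thesis
      using card_cycles_comp_le[OF \<sigma>' i(1)] card_cycles_comp_le[OF \<tau>' i(2)]
      by (auto simp: perms_below_def cycles_direct_sum(3)[OF \<sigma>' \<tau>'] cycles_direct_sum(3)[OF i]
          cycles_direct_sum(3)[OF \<sigma> \<tau>] direct_sum_inverse(1)[OF \<sigma>' \<tau>'] \<sigma>' \<tau>'
          inv_comp_cancel[OF \<sigma>'] inv_comp_cancel[OF \<tau>'])
  qed
  show ?thesis
  proof (rule bij_betw_imageI)
    show "inj_on (\<lambda>(\<sigma>', \<tau>'). direct_sum n \<sigma>' \<tau>') (perms_below n \<sigma> \<times> perms_below l \<tau>)"
    proof (rule inj_onI, clarify)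
      fix \<sigma>1 \<tau>1 \<sigma>2 \<tau>2
      assume eq: "direct_sum n \<sigma>1 \<tau>1 = direct_sum n \<sigma>2 \<tau>2"
        and "\<sigma>1 \<in> perms_below n \<sigma>" "\<sigma>2 \<in> perms_below n \<sigma>"
      then have fixed: "\<sigma>1 i = i" "\<sigma>2 i = i" if "\<not> i < n" for i
        using that perms_below_permutes permutes_not_in by (metis lessThan_iff)+
      have "\<sigma>1 i = \<sigma>2 i" for i
        using fun_cong[OF eq, of i] fixed[of i] by (cases "i < n") (auto simp: direct_sum_def)
      moreover have "\<tau>1 i = \<tau>2 i" for i
        using fun_cong[OF eq, of "n + i"] by (simp add: direct_sum_def)
      ultimately show "\<sigma>1 = \<sigma>2 \<and> \<tau>1 = \<tau>2" by blast
    qed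
    show "(\<lambda>(\<sigma>', \<tau>'). direct_sum n \<sigma>' \<tau>') ` (perms_below n \<sigma> \<times> perms_below l \<tau>) =
      perms_below (n + l) ?s"
    proof (intro equalityI subsetI)
      fix \<alpha> assume "\<alpha> \<in> (\<lambda>(\<sigma>', \<tau>'). direct_sum n \<sigma>' \<tau>') ` (perms_below n \<sigma> \<times> perms_below l \<tau>)"
      then obtain \<sigma>' \<tau>' where "\<sigma>' \<in> perms_below n \<sigma>" "\<tau>' \<in> perms_below l \<tau>" "\<alpha> = direct_sum n \<sigma>' \<tau>'"
        by auto
      then show "\<alpha> \<in> perms_below (n + l) ?s" using below perms_below_permutes by blast
    next
      fix \<alpha> assume \<alpha>: "\<alpha> \<in> perms_below (n + l) ?s"
      have "\<alpha> i < n" if "i < n" for i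
        using perms_below_refines[OF direct_sum_inverse(1)[OF \<sigma> \<tau>] \<alpha>, of i] that
          orbit.base[of \<alpha> i] permutes_orbit_subset[OF \<sigma>, of i]
        by (auto simp: orbit_direct_sum(1)[OF \<sigma> \<tau>])
      then obtain \<sigma>' \<tau>' where "\<sigma>' permutes {..<n}" "\<tau>' permutes {..<l}" "\<alpha> = direct_sum n \<sigma>' \<tau>'"
        using direct_sum_decomposition[OF perms_below_permutes[OF \<alpha>]] by metis
      then show "\<alpha> \<in> (\<lambda>(\<sigma>', \<tau>'). direct_sum n \<sigma>' \<tau>') ` (perms_below n \<sigma> \<times> perms_below l \<tau>)"
        using \<alpha> below by force
    qed
  qed
qed

lemma sum_perms_below_direct_sum:
  assumes \<sigma>: "\<sigma> permutes {..<length xs}" and \<tau>: "\<tau> permutes {..<length ys}"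
  shows "(\<Sum>\<alpha>\<in>perms_below (length xs + length ys) (direct_sum (length xs) \<sigma> \<tau>). cycle_prod f \<alpha> (xs @ ys)) =
    (\<Sum>\<alpha>\<in>perms_below (length xs) \<sigma>. cycle_prod f \<alpha> xs) *
    (\<Sum>\<alpha>\<in>perms_below (length ys) \<tau>. cycle_prod f \<alpha> ys)"
proof -
  have "(\<Sum>\<alpha>\<in>perms_below (length xs + length ys) (direct_sum (length xs) \<sigma> \<tau>). cycle_prod f \<alpha> (xs @ ys)) =
    (\<Sum>(\<sigma>', \<tau>')\<in>perms_below (length xs) \<sigma> \<times> perms_below (length ys) \<tau>.
      cycle_prod f (direct_sum (length xs) \<sigma>' \<tau>') (xs @ ys))"
    by (subst sum.reindex_bij_betw[OF perms_below_direct_sum[OF \<sigma> \<tau>], symmetric])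
       (simp add: case_prod_unfold)
  also have "\<dots> = (\<Sum>(\<sigma>', \<tau>')\<in>perms_below (length xs) \<sigma> \<times> perms_below (length ys) \<tau>.
      cycle_prod f \<sigma>' xs * cycle_prod f \<tau>' ys)"
    by (intro sum.cong refl) (auto simp: cycle_prod_direct_sum perms_below_permutes)
  finally show ?thesis by (simp add: sum_product sum.cartesian_product)
qed

section \<open>The moment of a permutation\<close>

text \<open>
  The cycle of \<open>0\<close> is moved to the first \<open>n\<close> positions, in the order in which it is traversed.
\<close>

lemma conjugate_to_direct_sum:
  assumes \<sigma>: "\<sigma> permutes {..<k}" and k: "0 < k"
  obtains \<rho> n l \<tau> where "\<rho> permutes {..<k}" "k = n + l" "0 < n" "\<tau> permutes {..<l}"
    "conjugate \<rho> \<sigma> = direct_sum n (long_cycle n) \<tau>"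
proof -
  note p = permutes_permutation[OF \<sigma>]
  define n where "n = card (orbit \<sigma> 0)"
  define l where "l = k - n"
  define e where "e t = (\<sigma> ^^ t) 0" for t
  have e: "bij_betw e {..<n} (orbit \<sigma> 0)"
    using funpow_orbit_bij(1)[OF p, of 0] unfolding n_def e_def .
  have sub: "orbit \<sigma> 0 \<subseteq> {..<k}" using permutes_orbit_subset[OF \<sigma>] k by simp
  then have fin: "finite (orbit \<sigma> 0)" by (rule finite_subset) simp
  have nk: "n \<le> k" unfolding n_def using card_mono[OF _ sub] by simp
  have n0: "0 < n" unfolding n_def using fin orbit_nonempty[of \<sigma> 0] by (simp add: card_gt_0_iff)
  have "card {n..<k} = card ({..<k} - orbit \<sigma> 0)"
    using sub fin by (simp add: card_Diff_subset n_def)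
  then obtain g where g: "bij_betw g {n..<k} ({..<k} - orbit \<sigma> 0)"
    using finite_same_card_bij[of "{n..<k}" "{..<k} - orbit \<sigma> 0"] by auto
  \<comment> \<open>An enumeration of the orbit of \<open>0\<close> is extended to a permutation.\<close>
  define \<phi> where "\<phi> i = (if i < n then e i else if i < k then g i else i)" for i
  have "bij_betw \<phi> {..<n} (orbit \<sigma> 0)"
    using e by (subst bij_betw_cong[of _ _ e]) (auto simp: \<phi>_def)
  moreover have "bij_betw \<phi> {n..<k} ({..<k} - orbit \<sigma> 0)"
    using g by (subst bij_betw_cong[of _ _ g]) (auto simp: \<phi>_def)
  ultimately have "bij_betw \<phi> ({..<n} \<union> {n..<k}) (orbit \<sigma> 0 \<union> ({..<k} - orbit \<sigma> 0))"
    by (rule bij_betw_combine) auto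
  moreover have "{..<n} \<union> {n..<k} = {..<k}" "orbit \<sigma> 0 \<union> ({..<k} - orbit \<sigma> 0) = {..<k}"
    using nk sub by auto
  ultimately have "bij_betw \<phi> {..<k} {..<k}" by simp
  then have \<phi>: "\<phi> permutes {..<k}" by (rule bij_imp_permutes) (use nk in \<open>simp add: \<phi>_def\<close>)
  define \<alpha> where "\<alpha> = conjugate (inv \<phi>) \<sigma>"
  have \<alpha>: "\<alpha> permutes {..<k}" unfolding \<alpha>_def by (rule conjugate_permutes[OF permutes_inv[OF \<phi>] \<sigma>])
  have \<alpha>n: "\<alpha> t = long_cycle n t" if t: "t < n" for t
  proof -
    have "\<sigma> (\<phi> t) = e (Suc t)" using t by (simp add: \<phi>_def e_def)
    also have "\<dots> = \<phi> (long_cycle n t)"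
    proof (cases "Suc t = n")
      case True
      then have "e (Suc t) = e 0" using funpow_orbit_bij(2)[OF p, of 0] by (simp add: e_def n_def)
      then show ?thesis using True n0 t by (simp add: \<phi>_def long_cycle_apply)
    next
      case False
      then show ?thesis using t by (simp add: \<phi>_def long_cycle_apply)
    qed
    finally show ?thesis
      unfolding \<alpha>_def by (simp add: permutes_inv_inv[OF \<phi>] permutes_inverses[OF \<phi>])
  qed
  have kn: "k = n + l" using nk by (simp add: l_def)
  have "\<alpha> i < n" if "i < n" for i
    using \<alpha>n[OF that] permutes_in_image[OF long_cycle_permutes, of n i] that by simp
  then obtain \<gamma> \<tau> where \<gamma>: "\<gamma> permutes {..<n}" "\<tau> permutes {..<l}" "\<alpha> = direct_sum n \<gamma> \<tau>"
    using direct_sum_decomposition[of \<alpha> n l] \<alpha> kn by metis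
  have "\<gamma> = long_cycle n"
  proof
    fix i show "\<gamma> i = long_cycle n i"
    proof (cases "i < n")
      case True
      then show ?thesis using \<alpha>n[OF True] \<gamma>(3) by (simp add: direct_sum_def)
    next
      case False
      then show ?thesis using permutes_not_in[OF \<gamma>(1), of i] by (simp add: long_cycle_apply)
    qed
  qed
  then show ?thesis using that[OF permutes_inv[OF \<phi>] kn n0 \<gamma>(2)] \<gamma>(3) unfolding \<alpha>_def by simp
qed

text \<open>
  After a conjugation the first summand is a long cycle, where the formula is the defining relation
  of the free cumulants. The induction hypothesis covers the second summand, and both sides of the
  formula are multiplicative on direct sums.
\<close>

lemma moment_formula:
  assumes conj: "conjugation_invariant m" and f: "is_free_cumulants m f" and empty: "m {} [] = 1"
    and mult: "\<And>\<sigma> \<tau> xs ys. \<sigma> permutes {..<length xs} \<Longrightarrow> \<tau> permutes {..<length ys} \<Longrightarrow>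
      set xs \<subseteq> F \<Longrightarrow> set ys \<subseteq> F \<Longrightarrow>
      m (perm_diagram (length xs + length ys) (direct_sum (length xs) \<sigma> \<tau>)) (xs @ ys) =
      m (perm_diagram (length xs) \<sigma>) xs * m (perm_diagram (length ys) \<tau>) ys"
    and "\<sigma> permutes {..<length xs}" "set xs \<subseteq> F"
  shows "m (perm_diagram (length xs) \<sigma>) xs = (\<Sum>\<alpha>\<in>perms_below (length xs) \<sigma>. cycle_prod f \<alpha> xs)"
  using assms(5,6)
proof (induction xs arbitrary: \<sigma> rule: measure_induct_rule[of length])
  case (less xs)
  note \<sigma> = less.prems(1)
  show ?case
  proof (cases "xs = []")
    case True
    moreover have "perms_below 0 \<sigma> = {\<sigma>}"
      using self_below[OF \<sigma>] \<sigma> True by (auto simp: perms_below_def)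
    ultimately show ?thesis using empty by (simp add: perm_diagram_def cycle_prod_def cycles_def)
  next
    case False
    then obtain \<rho> n l \<tau> where \<rho>: "\<rho> permutes {..<length xs}" and nl: "length xs = n + l" "0 < n"
      and \<tau>: "\<tau> permutes {..<l}" and eq: "conjugate \<rho> \<sigma> = direct_sum n (long_cycle n) \<tau>"
      using conjugate_to_direct_sum[OF \<sigma>] by (metis length_greater_0_conv)
    define zs where "zs = permute_list (inv \<rho>) xs"
    define us where "us = take n zs"
    define vs where "vs = drop n zs"
    have zs: "zs = us @ vs" and len: "length us = n" "length vs = l"
      using nl by (simp_all add: us_def vs_def zs_def)
    have "set zs \<subseteq> set xs"
    proof
      fix z assume "z \<in> set zs"
      then obtain i where "i < length xs" "z = xs ! inv \<rho> i" by (auto simp: zs_def permute_list_def)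
      then show "z \<in> set xs" using permutes_in_image[OF permutes_inv[OF \<rho>], of i] by simp
    qed
    then have F: "set us \<subseteq> F" "set vs \<subseteq> F" using less.prems(2) by (auto simp: zs)
    have "m (perm_diagram (length xs) \<sigma>) xs = m (perm_diagram (n + l) (direct_sum n (long_cycle n) \<tau>)) zs"
      using conj \<sigma> \<rho> unfolding conjugation_invariant_def zs_def eq[symmetric] nl(1)[symmetric] by simp
    also have "\<dots> = m (perm_diagram n (long_cycle n)) us * m (perm_diagram l \<tau>) vs"
      using mult[of "long_cycle n" us \<tau> vs] long_cycle_permutes[of n] \<tau> F by (simp add: len zs)
    also have "m (perm_diagram n (long_cycle n)) us =
        (\<Sum>\<alpha>\<in>perms_below n (long_cycle n). cycle_prod f \<alpha> us)"
      by (rule long_cycle_moment[OF f len(1)])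
    also have "m (perm_diagram l \<tau>) vs = (\<Sum>\<alpha>\<in>perms_below l \<tau>. cycle_prod f \<alpha> vs)"
      using less.IH[of vs \<tau>] \<tau> F nl by (simp add: len)
    also have "(\<Sum>\<alpha>\<in>perms_below n (long_cycle n). cycle_prod f \<alpha> us) *
          (\<Sum>\<alpha>\<in>perms_below l \<tau>. cycle_prod f \<alpha> vs) =
        (\<Sum>\<alpha>\<in>perms_below (length xs) (conjugate \<rho> \<sigma>). cycle_prod f \<alpha> zs)"
      using sum_perms_below_direct_sum[of "long_cycle n" us \<tau> vs f] long_cycle_permutes[of n] \<tau>
      by (simp add: len zs nl eq)
    also have "\<dots> = (\<Sum>\<alpha>\<in>perms_below (length xs) \<sigma>. cycle_prod f (conjugate \<rho> \<alpha>) zs)"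
      by (rule sum.reindex_bij_betw[OF perms_below_conjugate_bij[OF \<rho> \<sigma>], symmetric])
    also have "\<dots> = (\<Sum>\<alpha>\<in>perms_below (length xs) \<sigma>. cycle_prod f \<alpha> xs)"
      unfolding zs_def using \<rho> perms_below_permutes free_cumulants_rotate1[OF conj f]
      by (intro sum.cong refl cycle_prod_conjugate) auto
    finally show ?thesis .
  qed
qed

section \<open>Permutation diagrams\<close>

lemma tensor_perm_diagrams:
  "tensor n (perm_diagram n \<sigma>) (perm_diagram l \<tau>) = perm_diagram (n + l) (direct_sum n \<sigma> \<tau>)"
  by (simp add: tensor_def perm_diagram_def lessThan_add image_Un image_image direct_sum_def)

text \<open>
  In the join, \<open>Top i\<close> is connected to \<open>Bot (\<sigma> i)\<close> and to \<open>Bot (\<tau> i)\<close>, and the latter is connected to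
  \<open>Top (\<sigma>\<^sup>-\<^sup>1 (\<tau> i))\<close>. So a block consists of a cycle of \<open>\<sigma>\<^sup>-\<^sup>1 \<circ> \<tau>\<close> in the top row and its image under \<open>\<sigma>\<close>
  in the bottom row.
\<close>

lemma join_perm_diagrams:
  assumes \<sigma>: "\<sigma> permutes {..<k}" and \<tau>: "\<tau> permutes {..<k}"
  shows "join (perm_diagram k \<sigma>) (perm_diagram k \<tau>) =
    (\<lambda>c. Top ` c \<union> Bot ` \<sigma> ` c) ` cycles k (inv \<sigma> \<circ> \<tau>)"
proof -
  define \<rho> where "\<rho> = inv \<sigma> \<circ> \<tau>"
  have \<rho>: "\<rho> permutes {..<k}" unfolding \<rho>_def by (rule permutes_compose[OF \<tau> permutes_inv[OF \<sigma>]])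
  note p = permutes_permutation[OF \<rho>]
  have \<sigma>\<rho>: "\<sigma> (\<rho> i) = \<tau> i" for i by (simp add: \<rho>_def permutes_inverses[OF \<sigma>])
  let ?P = "perm_diagram k \<sigma>" and ?Q = "perm_diagram k \<tau>" and ?V = "vertices k"
  define B where "B c = Top ` c \<union> Bot ` \<sigma> ` c" for c
  define R where "R = B ` cycles k \<rho>"
  have part: "partition_on ?V ?P" "partition_on ?V ?Q"
    using perm_diagram_partition[OF \<sigma>] perm_diagram_partition[OF \<tau>] by (auto simp: partitions_def)
  then have U: "\<Union>?P \<union> \<Union>?Q = ?V" by (simp add: partition_on_def)
  have ne: "{} \<notin> ?P \<union> ?Q" using part by (auto simp: partition_on_def)
  have cyc: "\<Union>(cycles k \<rho>) = {..<k}" "{} \<notin> cycles k \<rho>"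
    using partition_on_cycles[OF \<rho>] by (auto simp: partition_on_def)
  have "partition_on ?V R"
  proof (rule partition_onI)
    have "\<Union>R = Top ` \<Union>(cycles k \<rho>) \<union> Bot ` \<sigma> ` \<Union>(cycles k \<rho>)" by (auto simp: R_def B_def)
    then show "\<Union>R = ?V" by (simp add: cyc vertices_def permutes_image[OF \<sigma>])
    show "{} \<notin> R" using cyc(2) by (auto simp: R_def B_def)
    fix X Y assume "X \<in> R" "Y \<in> R" "X \<noteq> Y"
    then obtain c d where cd: "c \<in> cycles k \<rho>" "d \<in> cycles k \<rho>" "X = B c" "Y = B d" "c \<noteq> d"
      by (auto simp: R_def)
    then have "c \<inter> d = {}"
      using partition_on_cycles[OF \<rho>] by (auto simp: partition_on_def dest: disjointD)
    then show "disjnt X Y" using permutes_inj[OF \<sigma>] by (auto simp: cd B_def disjnt_def inj_eq)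
  qed
  moreover have "\<exists>X\<in>R. b \<subseteq> X" if b: "b \<in> ?P \<union> ?Q" for b
  proof -
    obtain i where i: "i < k" "b = {Top i, Bot (\<sigma> i)} \<or> b = {Top i, Bot (\<sigma> (\<rho> i))}"
      using b by (auto simp: perm_diagram_def \<sigma>\<rho>)
    then have "b \<subseteq> B (orbit \<rho> i)"
      using permutation_self_in_orbit[OF p, of i] orbit.base[of \<rho> i] by (auto simp: B_def)
    then show ?thesis using i(1) by (auto simp: R_def cycles_def)
  qed
  ultimately have kR: "keeps_connections ?P ?Q R" unfolding keeps_connections_def U by blast
  have "refines ?V R r" if r: "keeps_connections ?P ?Q r" for r
    unfolding refines_def
  proof (intro conjI ballI)
    show "partition_on ?V R" by fact
    show pr: "partition_on ?V r" using r by (simp add: keeps_connections_def U)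
    have absorb: "b \<subseteq> Y" if b: "b \<in> ?P \<union> ?Q" "Y \<in> r" "x \<in> b" "x \<in> Y" for b Y x
    proof -
      obtain c where c: "c \<in> r" "b \<subseteq> c" using r b(1) unfolding keeps_connections_def by blast
      then have "c \<inter> Y \<noteq> {}" using b by auto
      then have "c = Y" using disjointD[OF partition_onD2[OF pr] c(1) b(2)] by auto
      then show ?thesis using c by simp
    qed
    fix X assume "X \<in> R"
    then obtain x where x: "x < k" "X = B (orbit \<rho> x)" by (auto simp: R_def cycles_def)
    then have "Top x \<in> ?V" by (simp add: vertices_def)
    then obtain Y where Y: "Y \<in> r" "Top x \<in> Y" using pr by (auto simp: partition_on_def)
    have row: "{Top i, Bot (\<sigma> i)} \<in> ?P" "{Top i, Bot (\<tau> i)} \<in> ?Q" if "i < k" for i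
      using that by (auto simp: perm_diagram_def)
    have follow: "Top (\<rho> i) \<in> Y \<and> Bot (\<sigma> (\<rho> i)) \<in> Y" if i: "i < k" "Top i \<in> Y" for i
    proof -
      have "Bot (\<tau> i) \<in> Y" using absorb[of "{Top i, Bot (\<tau> i)}" Y "Top i"] row(2)[OF i(1)] i Y by simp
      moreover have "\<rho> i < k" using permutes_in_image[OF \<rho>, of i] i by simp
      ultimately show ?thesis
        using absorb[of "{Top (\<rho> i), Bot (\<sigma> (\<rho> i))}" Y "Bot (\<sigma> (\<rho> i))"] row(1)[of "\<rho> i"] Y
        by (simp add: \<sigma>\<rho>)
    qed
    have "y < k \<and> Top y \<in> Y \<and> Bot (\<sigma> y) \<in> Y" if "y \<in> orbit \<rho> x" for y
      using that
    proof induction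
      case base
      show ?case using follow[of x] x Y permutes_in_image[OF \<rho>, of x] by simp
    next
      case (step y)
      then show ?case using follow[of y] permutes_in_image[OF \<rho>, of y] by simp
    qed
    then have "X \<subseteq> Y" unfolding x B_def by blast
    then show "\<exists>Y\<in>r. X \<subseteq> Y" using Y by blast
  qed
  then have "refines ?V R (join ?P ?Q)" using join_properties(1)[OF ne] by blast
  moreover have "refines ?V (join ?P ?Q) R" using join_properties(2)[OF ne kR] by (simp add: U)
  ultimately have "join ?P ?Q = R" by (metis refines_asym)
  then show ?thesis by (simp add: R_def B_def \<rho>_def)
qed

lemma diagram_dist_perm_diagrams:
  assumes \<sigma>: "\<sigma> permutes {..<k}" and \<tau>: "\<tau> permutes {..<k}"
  shows "diagram_dist (perm_diagram k \<sigma>) (perm_diagram k \<tau>) = k - real (card (cycles k (inv \<sigma> \<circ> \<tau>)))"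
proof -
  have "card (perm_diagram k \<alpha>) = k" for \<alpha>
    unfolding perm_diagram_def by (subst card_image) (auto simp: inj_on_def doubleton_eq_iff)
  moreover have "inj_on (\<lambda>c. Top ` c \<union> Bot ` \<sigma> ` c) A" for A
  proof (rule inj_onI)
    fix c d assume "Top ` c \<union> Bot ` \<sigma> ` c = Top ` d \<union> Bot ` \<sigma> ` d"
    then have "Top -` (Top ` c \<union> Bot ` \<sigma> ` c) = Top -` (Top ` d \<union> Bot ` \<sigma> ` d)" by simp
    moreover have "Top -` (Top ` c \<union> Bot ` \<sigma> ` c) = c" for c by auto
    ultimately show "c = d" by simp
  qed
  ultimately show ?thesis
    by (simp add: diagram_dist_def join_perm_diagrams[OF \<sigma> \<tau>] card_image)
qed

lemma diagram_le_perm_diagrams: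
  assumes \<sigma>: "\<sigma> permutes {..<k}" and \<tau>: "\<tau> permutes {..<k}"
  shows "diagram_le k (perm_diagram k \<tau>) (perm_diagram k \<sigma>) \<longleftrightarrow> \<tau> \<in> perms_below k \<sigma>"
  using \<tau> unfolding diagram_le_def perms_below_def
  by (auto simp: diagram_dist_perm_diagrams[OF permutes_id \<sigma>] diagram_dist_perm_diagrams[OF permutes_id \<tau>]
      diagram_dist_perm_diagrams[OF \<tau> \<sigma>])

lemma inj_on_perm_diagram: "inj_on (perm_diagram k) {\<sigma>. \<sigma> permutes {..<k}}"
  by (rule inj_onI) (metis mem_Collect_eq perm_of_perm_diagram)

lemma perm_diagrams_below:
  assumes "\<sigma> permutes {..<k}"
  shows "{q \<in> perm_diagrams k. diagram_le k q (perm_diagram k \<sigma>)} = perm_diagram k ` perms_below k \<sigma>"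
  using diagram_le_perm_diagrams[OF assms] perms_below_permutes
  by (auto simp: perm_diagrams_def)

lemma perm_diagrams_subset:
  "perm_diagrams k \<subseteq> partitions k"
  using perm_diagram_partition by (auto simp: perm_diagrams_def)

text \<open>
  The moments of one fixed list determine its cumulants by induction along the order, so the
  moment relation has to be checked for the list \<open>xs\<close> only. This matters since the moments factorize
  only on the given family.
\<close>

lemma perm_cumulants_unique:
  assumes \<kappa>: "is_cumulants scale perm_diagrams m \<kappa>" and "length xs = k"
    and K: "\<And>\<sigma>. \<sigma> permutes {..<k} \<Longrightarrow>
      m (perm_diagram k \<sigma>) xs = (\<Sum>\<tau>\<in>perms_below k \<sigma>. K \<tau>)"
    and "\<sigma> permutes {..<k}"
  shows "\<kappa> (perm_diagram k \<sigma>) xs = K \<sigma>"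
proof -
  have "\<forall>\<sigma>. \<sigma> permutes {..<k} \<longrightarrow> p = perm_diagram k \<sigma> \<longrightarrow> \<kappa> p xs = K \<sigma>" for p
  proof (induction p rule: wf_induct_rule[OF wf_diagram_below[of perm_diagrams, OF perm_diagrams_subset]])
    case (1 p)
    show ?case
    proof (intro allI impI)
      fix \<sigma> assume \<sigma>: "\<sigma> permutes {..<k}" and p: "p = perm_diagram k \<sigma>"
      have inj: "inj_on (perm_diagram k) (perms_below k \<sigma>)"
        by (rule inj_on_subset[OF inj_on_perm_diagram]) (auto dest: perms_below_permutes)
      have "p \<in> perm_diagrams k" using \<sigma> by (auto simp: p perm_diagrams_def)
      then have "m p xs = (\<Sum>q\<in>{q \<in> perm_diagrams k. diagram_le k q p}. \<kappa> q xs)"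
        using \<kappa> assms(2) unfolding is_cumulants_def by blast
      also have "\<dots> = (\<Sum>\<tau>\<in>perms_below k \<sigma>. \<kappa> (perm_diagram k \<tau>) xs)"
        unfolding p perm_diagrams_below[OF \<sigma>] by (simp add: sum.reindex[OF inj])
      finally have "(\<Sum>\<tau>\<in>perms_below k \<sigma>. \<kappa> (perm_diagram k \<tau>) xs) = (\<Sum>\<tau>\<in>perms_below k \<sigma>. K \<tau>)"
        using K[OF \<sigma>] p by simp
      moreover have "(\<Sum>\<tau>\<in>perms_below k \<sigma> - {\<sigma>}. \<kappa> (perm_diagram k \<tau>) xs) =
          (\<Sum>\<tau>\<in>perms_below k \<sigma> - {\<sigma>}. K \<tau>)"
      proof (rule sum.cong[OF refl])
        fix \<tau> assume \<tau>: "\<tau> \<in> perms_below k \<sigma> - {\<sigma>}"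
        then have \<tau>p: "\<tau> permutes {..<k}" using perms_below_permutes by blast
        have "perm_diagram k \<tau> \<noteq> p"
          using inj_onD[OF inj_on_perm_diagram, of k \<tau> \<sigma>] \<tau> \<tau>p \<sigma> by (auto simp: p)
        moreover have "diagram_le k (perm_diagram k \<tau>) p"
          using diagram_le_perm_diagrams[OF \<sigma> \<tau>p] \<tau> by (simp add: p)
        ultimately have "(perm_diagram k \<tau>, p) \<in> diagram_below perm_diagrams"
          using \<tau>p \<sigma> unfolding diagram_below_def perm_diagrams_def p by blast
        then show "\<kappa> (perm_diagram k \<tau>) xs = K \<tau>" using 1 \<tau>p by blast
      qed
      ultimately show "\<kappa> p xs = K \<sigma>"
        using self_below[OF \<sigma>] by (simp add: sum.remove[of _ \<sigma>] p)
    qed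
  qed
  then show ?thesis using assms(4) by blast
qed

section \<open>Cumulants of deterministic \<open>U\<close>-invariant families\<close>

theorem theorem2p11:
  fixes scale :: "complex \<Rightarrow> 'a::ring \<Rightarrow> 'a"
    and \<A> :: "nat \<Rightarrow> diagram set"
    and m :: "diagram \<Rightarrow> 'a list \<Rightarrow> complex"
    and as :: "'a list"
    and k :: nat
    and p :: diagram
    and start :: "nat set \<Rightarrow> nat"
  assumes "\<A> \<in> {partitions, pairings, perm_diagrams, even_partitions, partial_pairings}"
    and "tracial_algebra scale \<A> m"
    and "length as = k"
    and "deterministic scale \<A> m (set as)"
    and "U_invariant scale \<A> m (set as)"
    and "p \<in> \<A> k"
    and "\<And>c. p \<in> perm_diagrams k \<Longrightarrow> c \<in> cycles k (perm_of k p) \<Longrightarrow> start c \<in> c"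
  shows "cumulant scale \<A> m p as =
    (if p \<in> perm_diagrams k
     then \<Prod>c\<in>cycles k (perm_of k p). free_cumulant m (along_cycle (perm_of k p) (start c) as)
     else 0)"
proof -
  interpret tracial_algebra scale \<A> m by (rule assms(2))
  have U: "cumulant scale \<A> m p as =
      (if p \<in> perm_diagrams k then cumulant scale perm_diagrams m p as else 0)"
    using assms(3,5,6) unfolding U_invariant_def by blast
  show ?thesis
  proof (cases "p \<in> perm_diagrams k")
    case False
    then show ?thesis using U by simp
  next
    case True
    then obtain \<sigma> where \<sigma>: "\<sigma> permutes {..<k}" and p: "p = perm_diagram k \<sigma>"
      by (auto simp: perm_diagrams_def)
    define f where "f = free_cumulant m"
    have f: "is_free_cumulants m f"
      unfolding f_def free_cumulant_def by (rule theI'[OF free_cumulants_ex1[of m, OF empty]])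
    have sup: "perm_diagram n \<alpha> \<in> \<A> n" if "\<alpha> permutes {..<n}" for n \<alpha>
    proof -
      have "perm_diagram n \<alpha> \<in> perm_diagrams n" using that by (auto simp: perm_diagrams_def)
      moreover have "\<forall>b\<in>perm_diagram n \<alpha>. card b = 2" by (auto simp: perm_diagram_def)
      ultimately show ?thesis
        using assms(1) perm_diagram_partition[OF that]
        by (auto simp: pairings_def even_partitions_def partial_pairings_def)
    qed
    have conj: "conjugation_invariant m"
      unfolding conjugation_invariant_def
    proof (intro allI impI)
      fix \<alpha> \<rho> and xs :: "'a list"
      assume \<alpha>: "\<alpha> permutes {..<length xs}" and \<rho>: "\<rho> permutes {..<length xs}"
      show "m (perm_diagram (length xs) (conjugate \<rho> \<alpha>)) (permute_list (inv \<rho>) xs) =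
          m (perm_diagram (length xs) \<alpha>) xs"
        using conjugation[OF sup[OF \<alpha>] \<rho> refl] diagram_comp_perm[OF \<rho> \<alpha>]
          diagram_comp_perm[OF permutes_compose[OF \<alpha> \<rho>] permutes_inv[OF \<rho>]]
        by (simp add: permute_list_def)
    qed
    have gen: "set as \<subseteq> generated_algebra scale (set as)"
      unfolding generated_algebra_def by (rule hull_subset)
    have mult: "m (perm_diagram (length xs + length ys) (direct_sum (length xs) \<alpha> \<beta>)) (xs @ ys) =
        m (perm_diagram (length xs) \<alpha>) xs * m (perm_diagram (length ys) \<beta>) ys"
      if "\<alpha> permutes {..<length xs}" "\<beta> permutes {..<length ys}" "set xs \<subseteq> set as" "set ys \<subseteq> set as"
      for \<alpha> \<beta> and xs ys :: "'a list"
    proof -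
      have "set (xs @ ys) \<subseteq> generated_algebra scale (set as)" using that gen by auto
      then have "m (tensor (length xs) (perm_diagram (length xs) \<alpha>) (perm_diagram (length ys) \<beta>)) (xs @ ys) =
          m (perm_diagram (length xs) \<alpha>) xs * m (perm_diagram (length ys) \<beta>) ys"
        using assms(4) sup[OF that(1)] sup[OF that(2)] unfolding deterministic_def by blast
      then show ?thesis by (simp add: tensor_perm_diagrams)
    qed
    have \<kappa>: "is_cumulants scale perm_diagrams m (cumulant scale perm_diagrams m)"
      unfolding cumulant_def by (rule theI'[OF tracial_cumulants_ex1(2)[OF assms(1)]])
    have moments: "m (perm_diagram k \<alpha>) as = (\<Sum>\<tau>\<in>perms_below k \<alpha>. cycle_prod f \<tau> as)"
      if "\<alpha> permutes {..<k}" for \<alpha>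
      unfolding assms(3)[symmetric]
    proof (rule moment_formula[where F = "set as"])
      show "conjugation_invariant m" "is_free_cumulants m f" "m {} [] = 1" by (rule conj f empty)+
      show "\<alpha> permutes {..<length as}" "set as \<subseteq> set as" using that assms(3) by auto
    qed (rule mult)
    have "cumulant scale perm_diagrams m p as = cycle_prod f \<sigma> as"
      unfolding p
      by (rule perm_cumulants_unique[where K = "\<lambda>\<tau>. cycle_prod f \<tau> as", OF \<kappa> assms(3) moments \<sigma>])
    also have "\<dots> = (\<Prod>c\<in>cycles k \<sigma>. f (along_cycle \<sigma> (start c) as))"
      using cycle_prod_start[of \<sigma> as start f] \<sigma> assms(3) assms(7)[OF True]
        free_cumulants_rotate1[OF conj f]
      by (simp add: p perm_of_perm_diagram[OF \<sigma>])
    finally show ?thesis using U True by (simp add: f_def p perm_of_perm_diagram[OF \<sigma>])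
  qed
qed

end
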